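(* Let $A$ be a uniform algebra, let $Q$ be a compact Hausdorff space, and suppose that $B$ is a norm closed subalgebra of $C(Q)$ containing the constant functions. Then every weak-2-local isometry $\Delta:A\to B$ is a linear map. Respectively, every weak-2-local (algebraic) isomorphism $\Delta:A\to B$ is a linear map.
   Context: $C(K)$ denotes the algebra of complex-valued continuous functions on a compact Hausdorff space $K$ with the supremum norm. A uniform algebra is a norm closed subalgebra of some $C(K)$ ($K$ compact Hausdorff) which contains the constant functions and separates the points of $K$. For Banach spaces $X,Y$, $\mathrm{Iso}(X,Y)$ denotes the set of all surjective linear isometries from $X$ onto $Y$. A (not necessarily linear nor continuous) mapping $\Delta:X\to Y$ is a weak-2-local isometry if for each $x,y\in X$ and $\phi\in Y^*$ there exists $T_{x,y,\phi}\in\mathrm{Iso}(X,Y)$, depending on $x$, $y$ and $\phi$, with $\phi(\Delta(x))=\phi(T_{x,y,\phi}(x))$ and $\phi(\Delta(y))=\phi(T_{x,y,\phi}(y))$. A weak-2-local isomorphism $\Delta:A\to B$ between Banach algebras is defined in the same way, with $\mathrm{Iso}(X,Y)$ replaced by the set of all (bijective) algebra isomorphisms from $A$ onto $B$. *)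

theory Defs
  imports "HOL-Analysis.Analysis"
begin

text \<open>
  For a compact Hausdorff space \<open>K\<close>, given as a type, \<open>C(K)\<close> is the type \<open>'k \<Rightarrow>\<^sub>C complex\<close> of bounded
  continuous functions: boundedness is automatic when \<open>compact (UNIV :: 'k set)\<close>, and the library's
  norm on this type is the supremum norm. The library has the real normed space only; the pointwise
  product and the complex scalar multiplication are added here.
\<close>

lemma bcontfun_mult:
  fixes f g :: "'a::topological_space \<Rightarrow> 'b::real_normed_algebra"
  assumes "f \<in> bcontfun" "g \<in> bcontfun"
  shows "(\<lambda>x. f x * g x) \<in> bcontfun"
proof -
  obtain M N where M: "\<And>x. norm (f x) \<le> M" and N: "\<And>x. norm (g x) \<le> N"
    using assms by (auto simp: bcontfun_def bounded_iff)
  have "norm (f x * g x) \<le> M * N" for x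
    using norm_mult_ineq[of "f x" "g x"] mult_mono[OF M[of x] N[of x]] M[of x] norm_ge_zero[of "f x"]
    by (smt (verit) norm_ge_zero)
  then show ?thesis
    using assms by (auto simp: bcontfun_def bounded_iff intro: continuous_on_mult)
qed

instantiation bcontfun :: (topological_space, real_normed_algebra) real_normed_algebra
begin

definition times_bcontfun :: "('a \<Rightarrow>\<^sub>C 'b) \<Rightarrow> ('a \<Rightarrow>\<^sub>C 'b) \<Rightarrow> 'a \<Rightarrow>\<^sub>C 'b" where
  "times_bcontfun f g = Bcontfun (\<lambda>x. apply_bcontfun f x * apply_bcontfun g x)"

lemma times_bcontfun_apply [simp]: "apply_bcontfun (f * g) x = apply_bcontfun f x * apply_bcontfun g x"
  by (simp add: times_bcontfun_def Bcontfun_inverse bcontfun_mult apply_bcontfun)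

instance
proof
  fix f g :: "'a \<Rightarrow>\<^sub>C 'b"
  show "norm (f * g) \<le> norm f * norm g"
  proof (rule norm_bound)
    fix x
    have "norm (f x * g x) \<le> norm (f x) * norm (g x)"
      by (rule norm_mult_ineq)
    also have "\<dots> \<le> norm f * norm g"
      by (intro mult_mono norm_bounded) auto
    finally show "norm (apply_bcontfun (f * g) x) \<le> norm f * norm g"
      by simp
  qed
qed (auto intro!: bcontfun_eqI simp: algebra_simps)

end

instantiation bcontfun :: (topological_space, real_normed_algebra_1) real_normed_algebra_1
begin

definition one_bcontfun :: "'a \<Rightarrow>\<^sub>C 'b" where "one_bcontfun = const_bcontfun 1"

lemma one_bcontfun_apply [simp]: "apply_bcontfun 1 x = 1"
  by (simp add: one_bcontfun_def)

instance
proof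
  show "(0 :: 'a \<Rightarrow>\<^sub>C 'b) \<noteq> 1"
    by (metis one_bcontfun_apply zero_bcontfun.rep_eq zero_neq_one)
  show "norm (1 :: 'a \<Rightarrow>\<^sub>C 'b) = 1"
    by (simp add: norm_bcontfun_def dist_bcontfun_def)
qed (auto intro!: bcontfun_eqI)

end

instance bcontfun :: (topological_space, "{real_normed_algebra, comm_ring}") comm_ring
  by standard (auto intro!: bcontfun_eqI simp: algebra_simps)

instance bcontfun :: (topological_space, "{real_normed_algebra_1, comm_ring_1}") comm_ring_1
  by standard auto

definition scaleC_bcontfun :: "complex \<Rightarrow> ('a::topological_space \<Rightarrow>\<^sub>C complex) \<Rightarrow> 'a \<Rightarrow>\<^sub>C complex"
    (infixr \<open>*\<^sub>C\<close> 75)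
  where "c *\<^sub>C f = Bcontfun (\<lambda>x. c * apply_bcontfun f x)"

lemma scaleC_bcontfun_apply [simp]: "apply_bcontfun (c *\<^sub>C f) x = c * apply_bcontfun f x"
  by (simp add: scaleC_bcontfun_def Bcontfun_inverse bcontfun_mult const_bcontfun apply_bcontfun)

lemma vector_space_scaleC: "vector_space scaleC_bcontfun"
  by standard (auto intro!: bcontfun_eqI simp: algebra_simps)

definition subalgebra :: "('k::topological_space \<Rightarrow>\<^sub>C complex) set \<Rightarrow> bool" where
  "subalgebra A \<longleftrightarrow> module.subspace scaleC_bcontfun A \<and> (\<forall>f\<in>A. \<forall>g\<in>A. f * g \<in> A)"

definition uniform_algebra :: "('k::t2_space \<Rightarrow>\<^sub>C complex) set \<Rightarrow> bool" where
  "uniform_algebra A \<longleftrightarrow>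
     compact (UNIV :: 'k set) \<and> closed A \<and> subalgebra A \<and> (\<forall>c. const_bcontfun c \<in> A) \<and>
     (\<forall>s t. s \<noteq> t \<longrightarrow> (\<exists>f\<in>A. apply_bcontfun f s \<noteq> apply_bcontfun f t))"

text \<open>
  Maps between subspaces \<open>A\<close> and \<open>B\<close> are functions on the ambient types of which only the
  restriction to \<open>A\<close> matters. In \<open>clinear_on\<close> the codomain scalar multiplication \<open>s\<close> is a parameter,
  so that functionals (with \<open>s\<close> the multiplication of \<open>complex\<close>) are covered as well.
\<close>

definition clinear_on ::
    "('k::topological_space \<Rightarrow>\<^sub>C complex) set \<Rightarrow> (complex \<Rightarrow> 'v \<Rightarrow> 'v) \<Rightarrow>
     (('k \<Rightarrow>\<^sub>C complex) \<Rightarrow> 'v::ab_group_add) \<Rightarrow> bool" where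
  "clinear_on A s T \<longleftrightarrow>
     (\<forall>f\<in>A. \<forall>g\<in>A. T (f + g) = T f + T g) \<and> (\<forall>c. \<forall>f\<in>A. T (c *\<^sub>C f) = s c (T f))"

definition dual :: "('k::topological_space \<Rightarrow>\<^sub>C complex) set \<Rightarrow> (('k \<Rightarrow>\<^sub>C complex) \<Rightarrow> complex) set" where
  "dual B = {\<phi>. clinear_on B (*) \<phi> \<and> continuous_on B \<phi>}"

definition Iso ::
    "('k::topological_space \<Rightarrow>\<^sub>C complex) set \<Rightarrow> ('q::topological_space \<Rightarrow>\<^sub>C complex) set \<Rightarrow>
     (('k \<Rightarrow>\<^sub>C complex) \<Rightarrow> ('q \<Rightarrow>\<^sub>C complex)) set" where
  "Iso A B = {T. clinear_on A scaleC_bcontfun T \<and> T ` A = B \<and> (\<forall>f\<in>A. norm (T f) = norm f)}"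

definition AlgIso ::
    "('k::topological_space \<Rightarrow>\<^sub>C complex) set \<Rightarrow> ('q::topological_space \<Rightarrow>\<^sub>C complex) set \<Rightarrow>
     (('k \<Rightarrow>\<^sub>C complex) \<Rightarrow> ('q \<Rightarrow>\<^sub>C complex)) set" where
  "AlgIso A B = {T. clinear_on A scaleC_bcontfun T \<and> bij_betw T A B \<and>
                    (\<forall>f\<in>A. \<forall>g\<in>A. T (f * g) = T f * T g)}"

definition weak_2_local ::
    "(('k::topological_space \<Rightarrow>\<^sub>C complex) \<Rightarrow> ('q::topological_space \<Rightarrow>\<^sub>C complex)) set \<Rightarrow>
     ('k \<Rightarrow>\<^sub>C complex) set \<Rightarrow> ('q \<Rightarrow>\<^sub>C complex) set \<Rightarrow>
     (('k \<Rightarrow>\<^sub>C complex) \<Rightarrow> ('q \<Rightarrow>\<^sub>C complex)) \<Rightarrow> bool" where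
  "weak_2_local \<T> A B \<Delta> \<longleftrightarrow>
     \<Delta> \<in> A \<rightarrow> B \<and>
     (\<forall>f\<in>A. \<forall>g\<in>A. \<forall>\<phi>\<in>dual B. \<exists>T\<in>\<T>. \<phi> (\<Delta> f) = \<phi> (T f) \<and> \<phi> (\<Delta> g) = \<phi> (T g))"

definition weak_2_local_isometry ::
    "('k::topological_space \<Rightarrow>\<^sub>C complex) set \<Rightarrow> ('q::topological_space \<Rightarrow>\<^sub>C complex) set \<Rightarrow>
     (('k \<Rightarrow>\<^sub>C complex) \<Rightarrow> ('q \<Rightarrow>\<^sub>C complex)) \<Rightarrow> bool" where
  "weak_2_local_isometry A B = weak_2_local (Iso A B) A B"

definition weak_2_local_isomorphism ::
    "('k::topological_space \<Rightarrow>\<^sub>C complex) set \<Rightarrow> ('q::topological_space \<Rightarrow>\<^sub>C complex) set \<Rightarrow>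
     (('k \<Rightarrow>\<^sub>C complex) \<Rightarrow> ('q \<Rightarrow>\<^sub>C complex)) \<Rightarrow> bool" where
  "weak_2_local_isomorphism A B = weak_2_local (AlgIso A B) A B"

end

theory Submission
  imports Defs "HOL-Complex_Analysis.Complex_Analysis" "HOL-Computational_Algebra.Polynomial"
begin

text \<open>
  Composing \<open>\<Delta>\<close> with a point evaluation of \<open>B\<close> gives a scalar function \<open>D\<close> on \<open>A\<close>, and it suffices to show
  that every such \<open>D\<close> is complex linear. In both cases \<open>D a - D b\<close> is, up to a fixed unimodular factor, a
  value of a character-like functional at \<open>a - b\<close>; so \<open>D\<close> is \<open>1\<close>-Lipschitz, commutes with the addition of
  constants, and \<open>D a - D b\<close> stays away from \<open>0\<close> when \<open>a - b\<close> is invertible. This is the situation of the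
  Kowalski--Slodkowski theorem. Its usual proof differentiates \<open>D\<close> almost everywhere; here blow-up limits are
  used instead. The set of all such \<open>D\<close> is compact for pointwise convergence and invariant under translation and
  rescaling, and the elements of a minimal invariant subset are additive, hence complex linear by an argument
  of Gleason--Kahane--Zelazko type. Applied inside the set of functions that maximise the
  contour integral of \<open>t \<mapsto> D (t * x)\<close> over a parallelogram, this shows that all these integrals vanish, so
  \<open>t \<mapsto> D (y + t * x)\<close> is entire and Lipschitz, hence affine, which makes \<open>D\<close> linear.

  For isometries \<open>T\<close> one needs that \<open>T\<close> is a unimodular multiple of a multiplicative map. The ball-preserving
  vector fields \<open>c - cnj c * f * f\<close> on \<open>A\<close> and \<open>c * T 1 - cnj c * cnj (T 1) * g * g\<close> on \<open>B\<close> agree at the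
  origin under \<open>T\<close>; by Cartan's uniqueness principle they agree, so \<open>T (f * f) = cnj (T 1) * T f * T f\<close>.
\<close>

subsection \<open>Algebras of continuous functions\<close>

text \<open>Completeness makes the exponential and geometric series converge in these
  algebras.\<close>

instance bcontfun :: (topological_space, complete_space) complete_space
proof
  fix f :: "nat \<Rightarrow> 'a \<Rightarrow>\<^sub>C 'b"
  assume "Cauchy f"
  then have "uniformly_Cauchy_on UNIV (\<lambda>n. apply_bcontfun (f n))"
    unfolding uniformly_Cauchy_on_def Cauchy_def by (meson dist_fun_lt_imp_dist_val_lt)
  then obtain g where "uniform_limit UNIV (\<lambda>n. apply_bcontfun (f n)) g sequentially"
    by (metis Cauchy_uniformly_convergent uniformly_convergent_on_def)
  then obtain h where "f \<longlonglongrightarrow> h"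
    by (rule uniform_limit_bcontfunE) auto
  then show "convergent f"
    by (rule convergentI)
qed

instance bcontfun :: (topological_space, banach) banach ..

text \<open>The properties shared by \<open>A\<close> and \<open>B\<close>, so that every lemma of
  the locale is available on both sides of a map.\<close>

locale function_algebra =
  fixes A :: "('k::topological_space \<Rightarrow>\<^sub>C complex) set"
  assumes closed_A: "closed A"
    and subalgebra_A: "subalgebra A"
    and const_mem [simp, intro]: "const_bcontfun c \<in> A"

lemma scaleC_eq: "c *\<^sub>C f = const_bcontfun c * f"
  by (rule bcontfun_eqI) simp

lemma scaleR_eq: "r *\<^sub>R f = const_bcontfun (complex_of_real r) * f"
  for f :: "'k::topological_space \<Rightarrow>\<^sub>C complex"
  by (rule bcontfun_eqI) (simp add: scaleR_conv_of_real[where 'a = complex])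

lemma const_bcontfun_add: "const_bcontfun (a + b) = const_bcontfun a + const_bcontfun b"
  for a b :: "'b::real_normed_vector"
  by (rule bcontfun_eqI) simp

lemma const_bcontfun_mult: "const_bcontfun (a * b) = const_bcontfun a * const_bcontfun b"
  for a b :: "'b::real_normed_algebra"
  by (rule bcontfun_eqI) simp

lemma const_bcontfun_diff: "const_bcontfun (a - b) = const_bcontfun a - const_bcontfun b"
  for a b :: "'b::real_normed_vector"
  by (rule bcontfun_eqI) simp

lemma const_bcontfun_minus: "const_bcontfun (- a) = - const_bcontfun a"
  for a :: "'b::real_normed_vector"
  by (rule bcontfun_eqI) simp

lemma const_bcontfun_1: "const_bcontfun 1 = 1"
  by (rule bcontfun_eqI) simp

lemma const_bcontfun_power: "const_bcontfun (a ^ n) = const_bcontfun a ^ n"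
  for a :: "'b::real_normed_algebra_1"
  by (induction n) (auto simp: const_bcontfun_1 const_bcontfun_mult)

lemma norm_const_bcontfun [simp]: "norm (const_bcontfun c :: 'k::topological_space \<Rightarrow>\<^sub>C 'b) = norm c"
  for c :: "'b::real_normed_vector"
  using norm_bounded[of "const_bcontfun c :: 'k \<Rightarrow>\<^sub>C 'b"]
  by (intro antisym norm_bound) auto

lemma norm_const_mult [simp]: "norm (const_bcontfun c * f) = norm c * norm f"
  for f :: "'k::topological_space \<Rightarrow>\<^sub>C complex"
proof (cases "c = 0")
  case False
  show ?thesis
  proof (rule antisym)
    show "norm (const_bcontfun c * f) \<le> norm c * norm f"
      by (metis norm_const_bcontfun norm_mult_ineq)
    have "norm f \<le> norm (const_bcontfun c * f) / norm c"
    proof (rule norm_bound)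
      fix x
      have "norm c * norm (apply_bcontfun f x) \<le> norm (const_bcontfun c * f)"
        using norm_bounded[of "const_bcontfun c * f" x] by (simp add: norm_mult)
      then show "norm (apply_bcontfun f x) \<le> norm (const_bcontfun c * f) / norm c"
        using False by (simp add: field_simps)
    qed
    then show "norm c * norm f \<le> norm (const_bcontfun c * f)"
      using False by (simp add: field_simps)
  qed
qed simp

context function_algebra
begin

lemma add_mem [simp, intro]: "f \<in> A \<Longrightarrow> g \<in> A \<Longrightarrow> f + g \<in> A"
  using subalgebra_A vector_space_scaleC module.subspace_add
  by (metis module_iff_vector_space subalgebra_def)

lemma mult_mem [simp, intro]: "f \<in> A \<Longrightarrow> g \<in> A \<Longrightarrow> f * g \<in> A"
  using subalgebra_A by (auto simp: subalgebra_def)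

lemma zero_mem [simp, intro]: "0 \<in> A"
  by (metis const_mem const_bcontfun_0_eq_0)

lemma one_mem [simp, intro]: "1 \<in> A"
  by (metis const_mem const_bcontfun_1)

lemma minus_mem [simp, intro]: "f \<in> A \<Longrightarrow> - f \<in> A"
  using mult_mem[OF const_mem[of "-1"], of f] by (simp add: const_bcontfun_minus const_bcontfun_1)

lemma diff_mem [simp, intro]: "f \<in> A \<Longrightarrow> g \<in> A \<Longrightarrow> f - g \<in> A"
  using add_mem[of f "- g"] by simp

lemma scaleR_mem [simp, intro]: "f \<in> A \<Longrightarrow> r *\<^sub>R f \<in> A"
  by (simp add: scaleR_eq)

lemma power_mem [simp, intro]: "f \<in> A \<Longrightarrow> f ^ n \<in> A"
  by (induction n) auto

lemma sum_mem [intro]: "(\<And>i. i \<in> I \<Longrightarrow> f i \<in> A) \<Longrightarrow> sum f I \<in> A"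
  by (induction I rule: infinite_finite_induct) auto

text \<open>Closedness of \<open>A\<close> enters here: it keeps exponentials and geometric series
  of elements of \<open>A\<close> inside \<open>A\<close>.\<close>

lemma sums_mem: "f sums s \<Longrightarrow> (\<And>n. f n \<in> A) \<Longrightarrow> s \<in> A"
  using closed_sequentially[OF closed_A, of "\<lambda>n. sum f {..<n}" s] by (auto simp: sums_def)

lemma exp_mem [simp, intro]: "f \<in> A \<Longrightarrow> exp f \<in> A"
  by (rule sums_mem[OF exp_converges]) auto

end

lemma exp_mult_exp_minus: "exp y * exp (- y) = (1 :: 'k::topological_space \<Rightarrow>\<^sub>C complex)"
  by (rule exp_minus_inverse)

subsection \<open>Scalar functions invariant under translation and scaling\<close>

context function_algebra
begin

text \<open>The Kowalski--Slodkowski conditions on a scalar function of \<open>A\<close>. The usual requirement that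
  \<open>D a - D b\<close> lies in the spectrum of \<open>a - b\<close> is replaced by a weaker one that involves no spectrum and is
  closed under pointwise limits: if \<open>a - b\<close> is a multiple of an exponential, then \<open>D a - D b\<close> is bounded below
  in terms of the norm of its inverse. Values outside \<open>A\<close> are set to \<open>0\<close>, which makes the set compact.\<close>

definition admissible :: "(('k \<Rightarrow>\<^sub>C complex) \<Rightarrow> complex) set" where
  "admissible = {D. (\<forall>a. a \<notin> A \<longrightarrow> D a = 0) \<and> D 0 = 0 \<and>
     (\<forall>a\<in>A. \<forall>b\<in>A. cmod (D a - D b) \<le> norm (a - b)) \<and>
     (\<forall>a\<in>A. \<forall>s. D (a + const_bcontfun s) = D a + s) \<and>
     (\<forall>a\<in>A. \<forall>y\<in>A. \<forall>c. cmod c \<le> cmod (D (a + const_bcontfun c * exp y) - D a) * norm (exp (- y)))}"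

lemma admissibleD:
  assumes "D \<in> admissible"
  shows admissible_outside: "a \<notin> A \<Longrightarrow> D a = 0"
    and admissible_0: "D 0 = 0"
    and admissible_lipschitz: "a \<in> A \<Longrightarrow> b \<in> A \<Longrightarrow> cmod (D a - D b) \<le> norm (a - b)"
    and admissible_const: "a \<in> A \<Longrightarrow> D (a + const_bcontfun s) = D a + s"
    and admissible_exp: "a \<in> A \<Longrightarrow> y \<in> A \<Longrightarrow>
      cmod c \<le> cmod (D (a + const_bcontfun c * exp y) - D a) * norm (exp (- y))"
  using assms by (auto simp: admissible_def)

lemma admissible_norm: "D \<in> admissible \<Longrightarrow> cmod (D a) \<le> norm a"
  using admissible_lipschitz[of D a 0] admissible_0[of D] admissible_outside[of D a]
  by (cases "a \<in> A") auto

lemma closed_admissible: "closed admissible"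
  unfolding admissible_def Ball_def
  by (intro closed_Collect_conj closed_Collect_all closed_Collect_imp open_Collect_const
      closed_Collect_le closed_Collect_eq continuous_intros continuous_on_product_coordinates)

text \<open>By Tychonoff's theorem: the Lipschitz condition and \<open>D 0 = 0\<close> place
  \<open>admissible\<close> in a product of closed discs, and each of its conditions is closed for
  pointwise convergence.\<close>

lemma compact_admissible: "compact admissible"
proof -
  have "compactin (product_topology (\<lambda>a. euclidean) UNIV) (PiE UNIV (\<lambda>a::'k \<Rightarrow>\<^sub>C complex. cball (0::complex) (norm a)))"
    unfolding compactin_PiE by (simp add: compact_cball)
  then have "compact (PiE UNIV (\<lambda>a::'k \<Rightarrow>\<^sub>C complex. cball (0::complex) (norm a)))"
    by (simp add: euclidean_product_topology)
  moreover have "admissible \<subseteq> PiE UNIV (\<lambda>a. cball 0 (norm a))"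
    using admissible_norm by auto
  ultimately show ?thesis
    by (metis closed_admissible compact_Int_closed inf.absorb_iff2)
qed

text \<open>\<open>tr\<close> recentres \<open>D\<close> at the point \<open>y\<close>;
  \<open>dbl\<close> below magnifies \<open>D\<close> around the origin by the factor 2. Combining
  the two produces the blow-ups of \<open>D\<close>.\<close>

definition tr :: "('k \<Rightarrow>\<^sub>C complex) \<Rightarrow> (('k \<Rightarrow>\<^sub>C complex) \<Rightarrow> complex) \<Rightarrow> ('k \<Rightarrow>\<^sub>C complex) \<Rightarrow> complex" where
  "tr y D = (\<lambda>x. if x \<in> A then D (y + x) - D y else 0)"

definition dbl :: "(('k \<Rightarrow>\<^sub>C complex) \<Rightarrow> complex) \<Rightarrow> ('k \<Rightarrow>\<^sub>C complex) \<Rightarrow> complex" where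
  "dbl D = (\<lambda>x. 2 * D ((1/2) *\<^sub>R x))"

lemma tr_apply [simp]: "x \<in> A \<Longrightarrow> tr y D x = D (y + x) - D y"
  by (simp add: tr_def)

lemma tr_tr: "y \<in> A \<Longrightarrow> z \<in> A \<Longrightarrow> tr z (tr y D) = tr (y + z) D"
  by (auto simp: tr_def fun_eq_iff add.assoc)

lemma tr_0: "D \<in> admissible \<Longrightarrow> tr 0 D = D"
  by (auto simp: tr_def fun_eq_iff admissible_0 admissible_outside)

lemma half_mem_iff: "(1/2) *\<^sub>R x \<in> A \<longleftrightarrow> x \<in> A"
proof
  assume "(1/2) *\<^sub>R x \<in> A"
  then have "2 *\<^sub>R ((1/2) *\<^sub>R x) \<in> A" by blast
  then show "x \<in> A" by simp
qed auto

lemma dbl_tr: "dbl (tr ((1/2) *\<^sub>R y) D) = tr y (dbl D)"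
  by (auto simp: tr_def dbl_def fun_eq_iff half_mem_iff scaleR_add_right algebra_simps)

lemma tr_admissible:
  assumes D: "D \<in> admissible" and y: "y \<in> A"
  shows "tr y D \<in> admissible"
  unfolding admissible_def
proof (intro CollectI conjI ballI allI impI)
  fix a b z c s
  show "a \<notin> A \<Longrightarrow> tr y D a = 0" by (simp add: tr_def)
  show "tr y D 0 = 0" by simp
  assume a: "a \<in> A"
  show "tr y D (a + const_bcontfun s) = tr y D a + s"
    using admissible_const[OF D, of "y + a" s] a y by (simp add: add.assoc)
  show "cmod (tr y D a - tr y D b) \<le> norm (a - b)" if "b \<in> A"
    using admissible_lipschitz[OF D, of "y + a" "y + b"] a y that by simp
  show "cmod c \<le> cmod (tr y D (a + const_bcontfun c * exp z) - tr y D a) * norm (exp (- z))" if "z \<in> A"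
    using admissible_exp[OF D, of "y + a" z c] a y that by (simp add: add.assoc)
qed

text \<open>All conditions are homogeneous of degree one; the additive constants \<open>s\<close>
  and the coefficients \<open>c\<close> are simply halved.\<close>

lemma dbl_admissible:
  assumes D: "D \<in> admissible"
  shows "dbl D \<in> admissible"
  unfolding admissible_def
proof (intro CollectI conjI ballI allI impI)
  fix a b z c s
  have eq: "(1/2) *\<^sub>R const_bcontfun u = const_bcontfun (u / 2)" for u :: complex
    by (rule bcontfun_eqI) (simp add: scaleR_conv_of_real[where 'a = complex])
  show "a \<notin> A \<Longrightarrow> dbl D a = 0" by (simp add: dbl_def admissible_outside[OF D] half_mem_iff)
  show "dbl D 0 = 0" by (simp add: dbl_def admissible_0[OF D])
  assume a: "a \<in> A"
  show "dbl D (a + const_bcontfun s) = dbl D a + s"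
    using admissible_const[OF D, of "(1/2) *\<^sub>R a" "s / 2"] a by (simp add: dbl_def scaleR_add_right eq)
  show "cmod (dbl D a - dbl D b) \<le> norm (a - b)" if "b \<in> A"
  proof -
    have "cmod (dbl D a - dbl D b) = 2 * cmod (D ((1/2) *\<^sub>R a) - D ((1/2) *\<^sub>R b))"
      unfolding dbl_def right_diff_distrib[symmetric] norm_mult by simp
    also have "\<dots> \<le> 2 * norm ((1/2) *\<^sub>R a - (1/2) *\<^sub>R b)"
      using admissible_lipschitz[OF D, of "(1/2) *\<^sub>R a" "(1/2) *\<^sub>R b"] a that by simp
    also have "\<dots> = norm (a - b)"
      unfolding scaleR_diff_right[symmetric] norm_scaleR by simp
    finally show ?thesis .
  qed
  show "cmod c \<le> cmod (dbl D (a + const_bcontfun c * exp z) - dbl D a) * norm (exp (- z))" if "z \<in> A"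
  proof -
    have "(1/2) *\<^sub>R (a + const_bcontfun c * exp z) = (1/2) *\<^sub>R a + const_bcontfun (c / 2) * exp z"
      unfolding scaleR_add_right mult_scaleR_left[symmetric] eq ..
    then have "cmod (dbl D (a + const_bcontfun c * exp z) - dbl D a)
        = 2 * cmod (D ((1/2) *\<^sub>R a + const_bcontfun (c / 2) * exp z) - D ((1/2) *\<^sub>R a))"
      unfolding dbl_def right_diff_distrib[symmetric] norm_mult by simp
    then show ?thesis
      using admissible_exp[OF D, of "(1/2) *\<^sub>R a" z "c / 2"] a that
      by (simp add: norm_divide field_simps)
  qed
qed

section \<open>Closed sets invariant under blow-up\<close>

definition invariant :: "(('k \<Rightarrow>\<^sub>C complex) \<Rightarrow> complex) set \<Rightarrow> bool" where
  "invariant C \<longleftrightarrow> C \<subseteq> admissible \<and> closed C \<and> C \<noteq> {} \<and>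
     (\<forall>D\<in>C. dbl D \<in> C) \<and> (\<forall>D\<in>C. \<forall>y\<in>A. tr y D \<in> C)"

lemma invariantD:
  assumes "invariant C"
  shows invariant_subset: "C \<subseteq> admissible" and invariant_closed: "closed C"
    and invariant_nonempty: "C \<noteq> {}"
    and invariant_dbl: "D \<in> C \<Longrightarrow> dbl D \<in> C"
    and invariant_tr: "D \<in> C \<Longrightarrow> y \<in> A \<Longrightarrow> tr y D \<in> C"
  using assms by (auto simp: invariant_def)

lemma invariant_compact: "invariant C \<Longrightarrow> compact C"
  by (metis closed_Int_compact compact_admissible inf.absorb1 invariant_closed invariant_subset)

lemma continuous_on_tr: "continuous_on S (tr y)"
proof -
  have "continuous_on UNIV (\<lambda>D x. tr y D x)"
    unfolding tr_def
  proof (rule continuous_on_coordinatewise_then_product)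
    show "continuous_on UNIV (\<lambda>D :: ('k \<Rightarrow>\<^sub>C complex) \<Rightarrow> complex. if x \<in> A then D (y + x) - D y else 0)" for x
      using continuous_on_diff[OF continuous_on_product_coordinates continuous_on_product_coordinates]
      by (cases "x \<in> A") auto
  qed
  then show ?thesis
    using continuous_on_subset by blast
qed

text \<open>The functional \<open>V\<close> is an average of its values at finer scale (\<open>avg\<close>), so near a maximiser most of
  the pieces are near-maximal. Under \<open>dbl\<close> a translation by \<open>y / 2\<close> becomes one by \<open>y\<close>, so finitely many
  translations can be started arbitrarily close to the identity (\<open>lip\<close>) and scaled up (\<open>climb\<close>). Compactness
  then yields a function at which \<open>V\<close> is maximal after every translation. This takes the place of
  differentiability almost everywhere.\<close>

lemma maximizing_invariant:
  fixes V :: "(('k \<Rightarrow>\<^sub>C complex) \<Rightarrow> complex) \<Rightarrow> real" and p :: "nat \<Rightarrow> 'k \<Rightarrow>\<^sub>C complex"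
  assumes inv: "invariant C"
    and cont: "continuous_on admissible V"
    and lip: "\<And>D z. D \<in> admissible \<Longrightarrow> z \<in> A \<Longrightarrow> \<bar>V (tr z D) - V D\<bar> \<le> L * norm z"
    and p: "\<And>k. k < n \<Longrightarrow> p k \<in> A" "0 < n" "p 0 = 0"
    and avg: "\<And>D. D \<in> admissible \<Longrightarrow> real n * V D = (\<Sum>k<n. V (tr (p k) (dbl D)))"
  obtains C' m where "invariant C'" "C' \<subseteq> C" "\<And>D y. D \<in> C' \<Longrightarrow> y \<in> A \<Longrightarrow> V (tr y D) = m"
    "\<And>D. D \<in> C \<Longrightarrow> V D \<le> m"
proof -
  note sub = subsetD[OF invariant_subset[OF inv]]
  note dbl_in = invariant_dbl[OF inv]
  note tr_in = invariant_tr[OF inv]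
  have contC: "continuous_on C V"
    using cont invariant_subset[OF inv] continuous_on_subset by blast
  have cont_tr: "continuous_on C (\<lambda>D. V (tr y D))" if "y \<in> A" for y
    by (rule continuous_on_compose2[OF contC continuous_on_tr]) (use that tr_in in auto)
  obtain D0 where D0: "D0 \<in> C" "\<And>D. D \<in> C \<Longrightarrow> V D \<le> V D0"
    using continuous_attains_sup[OF invariant_compact[OF inv] invariant_nonempty[OF inv] contC] by auto
  define m where "m = V D0"
  have le_m: "V D \<le> m" if "D \<in> C" for D
    using D0 that m_def by auto
  \<comment> \<open>By \<open>dbl_tr\<close>, translating by \<open>z / 2\<close> before
    magnification is translating by \<open>z\<close> after it, and translations commute.\<close>
  have avg_tr: "real n * V (tr ((1/2) *\<^sub>R z) D) = (\<Sum>k<n. V (tr z (tr (p k) (dbl D))))"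
    if "D \<in> C" "z \<in> A" for D z
  proof -
    have "real n * V (tr ((1/2) *\<^sub>R z) D) = (\<Sum>k<n. V (tr (p k) (tr z (dbl D))))"
      using avg[OF sub[OF tr_in[of D "(1/2) *\<^sub>R z"]]] that by (simp add: dbl_tr)
    also have "\<dots> = (\<Sum>k<n. V (tr z (tr (p k) (dbl D))))"
      using that p by (intro sum.cong) (auto simp: tr_tr add.commute)
    finally show ?thesis .
  qed
  have climb: "\<exists>D'\<in>C. (\<Sum>y\<in>Y. V (tr ((1/2)^j *\<^sub>R y) D)) \<le> (\<Sum>y\<in>Y. V (tr y D'))"
    if "finite Y" "Y \<subseteq> A" "D \<in> C" for Y j D
    using that(3)
  proof (induction j arbitrary: D)
    case 0
    then show ?case by auto
  next
    case (Suc j)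
    let ?z = "\<lambda>y. (1/2)^j *\<^sub>R y"
    let ?E = "\<lambda>k. tr (p k) (dbl D)"
    let ?t = "\<Sum>y\<in>Y. V (tr ((1/2)^Suc j *\<^sub>R y) D)"
    have E: "?E k \<in> C" if "k < n" for k
      using that p Suc dbl_in tr_in by auto
    have "real n * ?t = (\<Sum>y\<in>Y. \<Sum>k<n. V (tr (?z y) (?E k)))"
      unfolding sum_distrib_left
    proof (rule sum.cong)
      fix y assume "y \<in> Y"
      then have "y \<in> A" using \<open>Y \<subseteq> A\<close> by auto
      then show "real n * V (tr ((1/2)^Suc j *\<^sub>R y) D) = (\<Sum>k<n. V (tr (?z y) (?E k)))"
        using avg_tr[OF Suc.prems, of "?z y"] by simp
    qed simp
    also have "\<dots> = (\<Sum>k<n. \<Sum>y\<in>Y. V (tr (?z y) (?E k)))"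
      by (rule sum.swap)
    finally have eq: "(\<Sum>k<n. \<Sum>y\<in>Y. V (tr (?z y) (?E k))) = real n * ?t" by simp
    \<comment> \<open>Pigeonhole: the average over the pieces is \<open>?t\<close>, so some piece
      does at least as well, with all displacements doubled.\<close>
    have "\<exists>k<n. ?t \<le> (\<Sum>y\<in>Y. V (tr (?z y) (?E k)))"
    proof (rule ccontr)
      assume "\<not> ?thesis"
      then have "(\<Sum>k<n. \<Sum>y\<in>Y. V (tr (?z y) (?E k))) < (\<Sum>k<n. ?t)"
        using \<open>0 < n\<close> by (intro sum_strict_mono[of "{..<n}"]) (auto simp: not_le simp del: power_Suc)
      then show False using eq by simp
    qed
    then obtain k where k: "k < n" "?t \<le> (\<Sum>y\<in>Y. V (tr (?z y) (?E k)))" by auto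
    then show ?case
      using Suc.IH[OF E[OF k(1)]] by force
  qed
  have finite_case: "\<exists>D\<in>C. \<forall>y\<in>Y. V (tr y D) = m" if Y: "finite Y" "Y \<subseteq> A" for Y
  proof -
    have "continuous_on C (\<lambda>D. \<Sum>y\<in>Y. V (tr y D))"
      using Y cont_tr by (intro continuous_on_sum) auto
    then obtain D1 where D1: "D1 \<in> C" "\<And>D. D \<in> C \<Longrightarrow> (\<Sum>y\<in>Y. V (tr y D)) \<le> (\<Sum>y\<in>Y. V (tr y D1))"
      using continuous_attains_sup[OF invariant_compact[OF inv] invariant_nonempty[OF inv]] by blast
    \<comment> \<open>At the global maximiser \<open>D0\<close>, translating by
      \<open>y / 2^j\<close> costs at most \<open>L * norm y / 2^j\<close>. \<open>climb\<close>
      replaces this by translations by \<open>y\<close> of another function without lowering the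
      sum.\<close>
    have lower: "real (card Y) * m - (1/2)^j * (\<Sum>y\<in>Y. L * norm y) \<le> (\<Sum>y\<in>Y. V (tr y D1))" for j
    proof -
      have "(\<Sum>y\<in>Y. m - (1/2)^j * (L * norm y)) \<le> (\<Sum>y\<in>Y. V (tr ((1/2)^j *\<^sub>R y) D0))"
      proof (rule sum_mono)
        fix y assume "y \<in> Y"
        then show "m - (1/2)^j * (L * norm y) \<le> V (tr ((1/2)^j *\<^sub>R y) D0)"
          using lip[OF sub[OF D0(1)], of "(1/2)^j *\<^sub>R y"] Y by (auto simp: m_def mult_ac)
      qed
      then show ?thesis
        using climb[OF Y D0(1), of j] D1(2) by (fastforce simp: sum_subtractf sum_distrib_left)
    qed
    have "(\<lambda>j. real (card Y) * m - (1/2)^j * (\<Sum>y\<in>Y. L * norm y))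
        \<longlonglongrightarrow> real (card Y) * m - 0 * (\<Sum>y\<in>Y. L * norm y)"
      by (intro tendsto_intros LIMSEQ_realpow_zero) auto
    then have "real (card Y) * m \<le> (\<Sum>y\<in>Y. V (tr y D1))"
      using lower LIMSEQ_le_const2 by fastforce
    moreover have le: "V (tr y D1) \<le> m" if "y \<in> Y" for y
      using that Y tr_in D1 le_m by auto
    moreover have "(\<Sum>y\<in>Y. V (tr y D1)) \<le> (\<Sum>y\<in>Y. m)"
      by (rule sum_mono) (rule le)
    ultimately have "(\<Sum>y\<in>Y. V (tr y D1)) = (\<Sum>y\<in>Y. m)" by simp
    then have "\<forall>y\<in>Y. V (tr y D1) = m"
      using sum_mono_inv[of "\<lambda>y. V (tr y D1)" Y "\<lambda>_. m"] le Y by blast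
    then show ?thesis using D1 by blast
  qed
  let ?S = "\<lambda>y. {D \<in> C. V (tr y D) = m}"
  have closed_S: "closed (?S y)" if "y \<in> A" for y
    by (rule continuous_closed_preimage_constant[OF cont_tr[OF that] invariant_closed[OF inv]])
  define C' where "C' = C \<inter> (\<Inter>y\<in>A. ?S y)"
  \<comment> \<open>Finite sets \<open>Y\<close> are settled by \<open>finite_case\<close>;
    compactness passes to all of \<open>A\<close> at once.\<close>
  have "C' \<noteq> {}"
    unfolding C'_def
  proof (rule compact_imp_fip_image[OF invariant_compact[OF inv] closed_S])
    fix Y assume "finite Y" "Y \<subseteq> A"
    then show "C \<inter> (\<Inter>y\<in>Y. ?S y) \<noteq> {}"
      using finite_case[of Y] by blast
  qed
  have C'_iff: "D \<in> C' \<longleftrightarrow> D \<in> C \<and> (\<forall>y\<in>A. V (tr y D) = m)" for D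
    by (auto simp: C'_def)
  have "tr z D \<in> C'" if "D \<in> C'" "z \<in> A" for D z
    using that tr_in by (auto simp: C'_iff tr_tr)
  moreover have "dbl D \<in> C'" if D: "D \<in> C'" for D
    unfolding C'_iff
  proof (intro conjI ballI)
    show C: "dbl D \<in> C" using that dbl_in by (auto simp: C'_iff)
    fix y assume y: "y \<in> A"
    let ?E = "\<lambda>k. tr y (tr (p k) (dbl D))"
    have E: "?E k \<in> C" if "k < n" for k
      using that y C tr_in p by auto
    have "(\<Sum>k<n. V (?E k)) = real n * V (tr ((1/2) *\<^sub>R y) D)"
      using avg_tr[of D y] D y by (auto simp: C'_iff)
    also have "\<dots> = (\<Sum>k<n. m)"
      using D y by (simp add: C'_iff)
    \<comment> \<open>The average of \<open>n\<close> numbers that are at most \<open>m\<close>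
      equals \<open>m\<close>, so each of them is \<open>m\<close>; the one for
      \<open>p 0 = 0\<close> is wanted.\<close>
    finally have "V (?E 0) = m"
      using sum_mono_inv[of "\<lambda>k. V (?E k)" "{..<n}" "\<lambda>_. m" 0] le_m[OF E] \<open>0 < n\<close> by auto
    then show "V (tr y (dbl D)) = m"
      using sub[OF C] by (simp add: p tr_0)
  qed
  moreover have "closed C'"
    unfolding C'_def using closed_S invariant_closed[OF inv] by auto
  ultimately have "invariant C'"
    using \<open>C' \<noteq> {}\<close> sub by (auto simp: invariant_def C'_iff)
  then show thesis
    by (rule that[of C' m]) (use le_m in \<open>auto simp: C'_iff\<close>)
qed

end

section \<open>Minimal invariant sets and additivity\<close>

context function_algebra
begin

text \<open>Zorn's lemma for reverse inclusion; compactness keeps the intersection of a chain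
  nonempty.\<close>

lemma minimal_invariant:
  assumes inv: "invariant C"
  obtains M where "invariant M" "M \<subseteq> C" "\<And>N. invariant N \<Longrightarrow> N \<subseteq> M \<Longrightarrow> N = M"
proof -
  let ?\<S> = "{N. invariant N \<and> N \<subseteq> C}"
  have "\<exists>M\<in>?\<S>. \<forall>N\<in>?\<S>. M \<supseteq> N \<longrightarrow> N = M"
  proof (rule predicate_Zorn)
    show "partial_order_on ?\<S> (relation_of (\<supseteq>) ?\<S>)"
      by (rule partial_order_on_relation_ofI) auto
    fix \<C> assume "\<C> \<in> Chains (relation_of (\<supseteq>) ?\<S>)"
    then have chain: "\<And>N. N \<in> \<C> \<Longrightarrow> invariant N \<and> N \<subseteq> C"
      and lin: "\<And>N N'. N \<in> \<C> \<Longrightarrow> N' \<in> \<C> \<Longrightarrow> N \<subseteq> N' \<or> N' \<subseteq> N"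
      unfolding Chains_def relation_of_def by auto
    \<comment> \<open>Inserting \<open>C\<close> provides a least member for the empty family
      too.\<close>
    have least: "\<exists>N0\<in>insert C \<F>. \<forall>N\<in>insert C \<F>. N0 \<subseteq> N" if "finite \<F>" "\<F> \<subseteq> \<C>" for \<F>
      using that
    proof (induction \<F> rule: finite_induct)
      case (insert N \<F>)
      then obtain N0 where N0: "N0 \<in> insert C \<F>" "\<forall>N\<in>insert C \<F>. N0 \<subseteq> N" by blast
      have "N \<subseteq> N0 \<or> N0 \<subseteq> N"
      proof (cases "N0 = C")
        case True
        then show ?thesis using insert.prems chain by auto
      next
        case False
        then have "N \<in> \<C>" "N0 \<in> \<C>" using N0(1) insert.prems by auto
        then show ?thesis by (rule lin)
      qed
      then show ?case
      proof
        assume "N \<subseteq> N0"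
        then have "\<forall>N'\<in>insert C (insert N \<F>). N \<subseteq> N'"
          using N0(2) by auto
        then show ?thesis by blast
      next
        assume "N0 \<subseteq> N"
        then have "\<forall>N'\<in>insert C (insert N \<F>). N0 \<subseteq> N'"
          using N0(2) by auto
        then show ?thesis using N0(1) by blast
      qed
    qed auto
    have "C \<inter> \<Inter>\<C> \<noteq> {}"
    proof (rule compact_imp_fip[OF invariant_compact[OF inv]])
      show "closed N" if "N \<in> \<C>" for N
        using chain[OF that] invariant_closed by auto
      fix \<F> assume \<F>: "finite \<F>" "\<F> \<subseteq> \<C>"
      obtain N0 where N0: "N0 \<in> insert C \<F>" "\<forall>N\<in>insert C \<F>. N0 \<subseteq> N"
        using least[OF \<F>] by blast
      have "invariant N0"
        using N0(1) inv chain[of N0] \<F>(2) by auto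
      then show "C \<inter> \<Inter>\<F> \<noteq> {}"
        using N0(2) invariant_nonempty[of N0] by blast
    qed
    have inv_all: "invariant N" if "N \<in> insert C \<C>" for N
      using that inv chain by auto
    define N where "N = \<Inter>(insert C \<C>)"
    have "closed N"
      unfolding N_def by (intro closed_Inter ballI invariant_closed inv_all)
    moreover have "dbl D \<in> N" if "D \<in> N" for D
      unfolding N_def
    proof (rule InterI)
      fix X assume X: "X \<in> insert C \<C>"
      then have "D \<in> X" using that by (auto simp: N_def)
      then show "dbl D \<in> X" by (rule invariant_dbl[OF inv_all[OF X]])
    qed
    moreover have "tr y D \<in> N" if "D \<in> N" "y \<in> A" for D y
      unfolding N_def
    proof (rule InterI)
      fix X assume X: "X \<in> insert C \<C>"
      then have "D \<in> X" using that by (auto simp: N_def)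
      then show "tr y D \<in> X" using that(2) by (rule invariant_tr[OF inv_all[OF X]])
    qed
    moreover have "N \<subseteq> admissible"
      using invariant_subset[OF inv] by (auto simp: N_def)
    moreover have "N \<noteq> {}"
      using \<open>C \<inter> \<Inter>\<C> \<noteq> {}\<close> by (simp add: N_def)
    ultimately have "invariant N"
      by (simp add: invariant_def)
    then show "\<exists>N\<in>?\<S>. \<forall>N'\<in>\<C>. N' \<supseteq> N"
      by (intro bexI[of _ N]) (auto simp: N_def)
  qed
  then obtain M where "invariant M" "M \<subseteq> C" and min: "\<forall>N\<in>?\<S>. M \<supseteq> N \<longrightarrow> N = M"
    by auto
  then show thesis
    by (intro that[of M]) auto
qed

text \<open>By minimality, the set on which every translate maximises \<open>Re (c * D x)\<close> is
  all of \<open>M\<close>. So \<open>Re (c * tr y D x)\<close> does not depend on \<open>y\<close>,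
  and \<open>y = 0\<close> gives \<open>Re (c * D x)\<close>.\<close>

lemma minimal_additive:
  assumes M: "invariant M" and min: "\<And>N. invariant N \<Longrightarrow> N \<subseteq> M \<Longrightarrow> N = M"
    and D: "D \<in> M" and x: "x \<in> A" and y: "y \<in> A"
  shows "D (y + x) = D y + D x"
proof -
  have Re_eq: "Re (c * (D (y + x) - D y)) = Re (c * D x)" for c
  proof -
    let ?V = "\<lambda>D. Re (c * D x)"
    obtain M' m where M': "invariant M'" "M' \<subseteq> M" "\<And>D y. D \<in> M' \<Longrightarrow> y \<in> A \<Longrightarrow> ?V (tr y D) = m"
      "\<And>D. D \<in> M \<Longrightarrow> ?V D \<le> m"
    proof (rule maximizing_invariant[OF M, of ?V "2 * cmod c" 2 "\<lambda>k. of_nat k * x"])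
      show "continuous_on admissible ?V"
        by (intro continuous_intros continuous_on_subset[OF continuous_on_product_coordinates]) auto
      show "\<bar>?V (tr z D) - ?V D\<bar> \<le> 2 * cmod c * norm z" if "D \<in> admissible" "z \<in> A" for D z
      proof -
        have "cmod (D (z + x) - D z - D x) \<le> 2 * norm z"
          using admissible_lipschitz[OF that(1), of "z + x" x] admissible_norm[OF that(1), of z]
            that x norm_triangle_ineq4[of "D (z + x) - D x" "D z"] by (simp add: algebra_simps)
        then have "cmod (c * (D (z + x) - D z - D x)) \<le> cmod c * (2 * norm z)"
          unfolding norm_mult by (intro mult_left_mono) auto
        moreover have "?V (tr z D) - ?V D = Re (c * (D (z + x) - D z - D x))"
          using x by (simp add: algebra_simps)
        ultimately show ?thesis
          using abs_Re_le_cmod[of "c * (D (z + x) - D z - D x)"] by linarith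
      qed
      \<comment> \<open>The segment from \<open>0\<close> to \<open>x\<close> is cut into halves.
        Magnified, they run from \<open>0\<close> to \<open>x\<close> and from \<open>x\<close> to
        \<open>x + x\<close>, and the increments telescope.\<close>
      show "real 2 * ?V D = (\<Sum>k<2. ?V (tr (of_nat k * x) (dbl D)))" if "D \<in> admissible" for D
      proof -
        have "(1/2) *\<^sub>R (x + x) = x"
          by (metis scaleR_half_double)
        then show ?thesis
          using x by (simp add: numeral_2_eq_2 dbl_def admissible_0[OF that] algebra_simps)
      qed
      show "of_nat k * x \<in> A" if "k < 2" for k
        using that x by (auto simp: less_2_cases_iff)
    qed auto
    then have "D \<in> M'" using min[of M'] D by auto
    then show ?thesis
      using M'(3)[of D y] M'(3)[of D 0] x y admissible_0[of D] invariant_subset[OF M] D by auto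
  qed
  show ?thesis
    using Re_eq[of 1] Re_eq[of "- \<i>"] by (simp add: complex_eq_iff)
qed

end

subsection \<open>Additive functions are complex linear\<close>

text \<open>The real part of a logarithm of \<open>p\<close> grows at most linearly, hence so does
  the logarithm itself, and Liouville's theorem makes it a linear polynomial.\<close>

lemma entire_zero_free_exp:
  assumes hol: "p holomorphic_on UNIV" and nz: "\<And>z. p z \<noteq> 0" and p0: "p 0 = 1"
    and growth: "\<And>z. cmod (p z) \<le> B * exp (K * cmod z)" and "1 \<le> B" "0 \<le> K"
  obtains \<alpha> where "\<And>z. p z = exp (\<alpha> * z)"
proof -
  obtain g0 where g0: "g0 holomorphic_on UNIV" "\<And>z. exp (g0 z) = p z"
    using holomorphic_logarithm_exists[OF convex_UNIV open_UNIV hol nz UNIV_I] by auto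
  define g where "g z = g0 z - g0 0" for z
  have hol_g: "g holomorphic_on S" for S
    unfolding g_def using holomorphic_on_subset[OF g0(1)] by (intro holomorphic_intros) auto
  have exp_g: "exp (g z) = p z" for z
    using g0(2)[of z] g0(2)[of 0] p0 by (simp add: g_def exp_diff)
  define L where "L = ln B + 1"
  have "1 \<le> L" using \<open>1 \<le> B\<close> by (simp add: L_def)
  have Re_g: "Re (g z) < L + K * cmod z" for z
  proof -
    have "exp (Re (g z)) \<le> exp (ln B + K * cmod z)"
      using growth[of z] \<open>1 \<le> B\<close> by (simp add: exp_g[symmetric] norm_exp_eq_Re exp_add)
    then show ?thesis by (simp add: L_def)
  qed
  \<comment> \<open>Borel--Caratheodory: the Schwarz lemma for \<open>g / (2 * M - g)\<close>.\<close>
  have bound: "cmod (g z) \<le> 2 * (L + K * (2 * cmod z))" if "z \<noteq> 0" for z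
  proof -
    define r where "r = 2 * cmod z"
    define M where "M = L + K * r"
    have "0 < r" using that by (simp add: r_def)
    have "0 < M" using \<open>1 \<le> L\<close> \<open>0 \<le> K\<close> \<open>0 < r\<close> by (simp add: M_def add_pos_nonneg)
    have Re_M: "Re (g (of_real r * w)) < M" if "cmod w < 1" for w
    proof -
      have "K * cmod (of_real r * w) \<le> K * r"
        using that \<open>0 < r\<close> \<open>0 \<le> K\<close> by (intro mult_left_mono) (auto simp: norm_mult mult_le_cancel_left1)
      then show ?thesis using Re_g[of "of_real r * w"] by (simp add: M_def)
    qed
    \<comment> \<open>The line of points with real part \<open>M\<close> is the perpendicular
      bisector of \<open>0\<close> and \<open>2 * M\<close>; points to its left are closer to
      \<open>0\<close>.\<close>
    have less: "cmod u < cmod (2 * of_real M - u)" if "Re u < M" for u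
    proof -
      have "0 < 4 * M * (M - Re u)" using that \<open>0 < M\<close> by simp
      then have "(cmod u)\<^sup>2 < (cmod (2 * of_real M - u))\<^sup>2"
        unfolding cmod_power2 by (simp add: power2_eq_square algebra_simps)
      then show ?thesis by (rule power_less_imp_less_base) simp
    qed
    define h where "h w = g (of_real r * w) / (2 * of_real M - g (of_real r * w))" for w
    have denom: "2 * of_real M - g (of_real r * w) \<noteq> 0" if "cmod w < 1" for w
      using less[OF Re_M[OF that]] by auto
    have "h holomorphic_on ball 0 1"
      unfolding h_def using denom
      by (intro holomorphic_intros holomorphic_on_compose_gen[OF _ hol_g[of UNIV], unfolded o_def]) auto
    moreover have "h 0 = 0" by (simp add: h_def g_def)
    moreover have "cmod (h w) < 1" if "cmod w < 1" for w
      using less[OF Re_M[OF that]] by (simp add: h_def norm_divide divide_less_eq)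
    moreover have half: "cmod (z / of_real r) = 1/2" using \<open>0 < r\<close> by (simp add: norm_divide r_def)
    ultimately have "cmod (h (z / of_real r)) \<le> 1/2"
      using Schwarz_Lemma(1)[of h "z / of_real r"] by simp
    moreover have "of_real r * (z / of_real r) = z" using \<open>0 < r\<close> by simp
    moreover have "2 * of_real M - g z \<noteq> 0"
      using denom[of "z / of_real r"] half \<open>0 < r\<close> by simp
    ultimately have "2 * cmod (g z) \<le> cmod (2 * of_real M - g z)"
      by (simp add: h_def norm_divide field_simps)
    also have "\<dots> \<le> 2 * M + cmod (g z)"
      using norm_triangle_ineq4[of "2 * of_real M" "g z"] \<open>0 < M\<close> by (simp add: norm_mult)
    finally show ?thesis by (simp add: M_def r_def)
  qed
  have lin: "g z = deriv g 0 * z" for z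
  proof -
    have "cmod (g w) \<le> (2 * L + 4 * K) * cmod w ^ 1" if "1 \<le> cmod w" for w
    proof -
      have "w \<noteq> 0" using that by auto
      then have "cmod (g w) \<le> 2 * L + 4 * (K * cmod w)"
        using bound[of w] by simp
      moreover have "L \<le> L * cmod w" using that \<open>1 \<le> L\<close> by simp
      ultimately show ?thesis by (simp add: algebra_simps)
    qed
    then have "g z = (\<Sum>k\<le>1. (deriv ^^ k) g 0 / fact k * z ^ k)"
      by (rule Liouville_polynomial[OF hol_g])
    then show ?thesis by (simp add: g_def)
  qed
  show thesis
    using that[of "deriv g 0"] lin exp_g by metis
qed

text \<open>The deviation from linearity at \<open>t\<close>, multiplied by \<open>n\<close>, equals
  the deviation at the fractional part of \<open>n * t\<close>, which is bounded independently of
  \<open>n\<close>.\<close>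

lemma additive_linear_bound:
  fixes f :: "real \<Rightarrow> 'a::real_normed_vector"
  assumes add: "\<And>s t. f (s + t) = f s + f t" and bound: "\<And>t. norm (f t) \<le> K * \<bar>t\<bar>"
  shows "f t = t *\<^sub>R f 1"
proof -
  have f0: "f 0 = 0" using add[of 0 0] by simp
  have fneg: "f (- s) = - f s" for s
    using add[of s "- s"] f0 by (simp add: eq_neg_iff_add_eq_0 add.commute)
  have fnat: "f (real n * s) = real n *\<^sub>R f s" for n s
    by (induction n) (auto simp: f0 add algebra_simps)
  have fint: "f (of_int k) = of_int k *\<^sub>R f 1" for k
    using fnat[of "nat k" 1] fnat[of "nat (- k)" 1] fneg[of "of_int (- k)"]
    by (cases "0 \<le> k") auto
  have "K \<ge> 0" using bound[of 1] norm_ge_zero[of "f 1"] by linarith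
  have le: "real n * norm (f t - t *\<^sub>R f 1) \<le> 2 * K" for n
  proof -
    define k where "k = \<lfloor>real n * t\<rfloor>"
    define d where "d = real n * t - of_int k"
    have d: "0 \<le> d" "d \<le> 1" unfolding d_def k_def by linarith+
    have "f (real n * t) = f (of_int k) + f d"
      using add[of "of_int k" d] by (simp add: d_def)
    then have "real n *\<^sub>R (f t - t *\<^sub>R f 1) = f d - d *\<^sub>R f 1"
      by (simp only: fnat fint d_def) (simp add: algebra_simps)
    then have "real n * norm (f t - t *\<^sub>R f 1) = norm (f d - d *\<^sub>R f 1)"
      by (metis abs_of_nat norm_scaleR)
    also have "\<dots> \<le> K * d + d * norm (f 1)"
      using norm_triangle_ineq4[of "f d" "d *\<^sub>R f 1"] bound[of d] d by simp
    also have "\<dots> \<le> K * 1 + 1 * K"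
      using d \<open>K \<ge> 0\<close> bound[of 1] by (intro add_mono mult_mono) auto
    finally show ?thesis by simp
  qed
  have "norm (f t - t *\<^sub>R f 1) \<le> 0"
  proof (rule ccontr)
    assume "\<not> ?thesis"
    then obtain n where "2 * K < real n * norm (f t - t *\<^sub>R f 1)"
      using reals_Archimedean3[of "norm (f t - t *\<^sub>R f 1)"] by (auto simp: not_le)
    then show False using le[of n] by simp
  qed
  then show ?thesis by simp
qed

context function_algebra
begin

text \<open>The Gleason--Kahane--Zelazko argument: \<open>z \<mapsto> \<phi> (exp (z * y))\<close>
  is entire, free of zeros and of exponential growth, so it equals
  \<open>exp (\<alpha> * z)\<close>; its derivative at \<open>0\<close> identifies
  \<open>\<alpha>\<close> as \<open>\<phi> y\<close>.\<close>

lemma linear_functional_exp: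
  assumes add: "\<And>f g. f \<in> A \<Longrightarrow> g \<in> A \<Longrightarrow> \<phi> (f + g) = \<phi> f + \<phi> g"
    and hom: "\<And>c f. f \<in> A \<Longrightarrow> \<phi> (const_bcontfun c * f) = c * \<phi> f"
    and bound: "\<And>f. f \<in> A \<Longrightarrow> cmod (\<phi> f) \<le> K * norm f"
    and one: "\<phi> 1 = 1" and nz: "\<And>f. f \<in> A \<Longrightarrow> \<phi> (exp f) \<noteq> 0"
    and y: "y \<in> A"
  shows "\<phi> (exp y) = exp (\<phi> y)"
proof -
  have zero: "\<phi> 0 = 0" using add[of 0 0] by simp
  have sum: "\<phi> (\<Sum>i<n. f i) = (\<Sum>i<n. \<phi> (f i))" if "\<And>i. f i \<in> A" for f and n :: nat
    by (induction n) (auto simp: zero add that sum_mem)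
  have diff: "\<phi> (f - g) = \<phi> f - \<phi> g" if "f \<in> A" "g \<in> A" for f g
    using add[of "f - g" g] that by simp
  have sums: "(\<lambda>n. \<phi> (f n)) sums \<phi> s" if "f sums s" "\<And>n. f n \<in> A" for f s
  proof -
    have s: "s \<in> A" using sums_mem that by blast
    have "(\<lambda>n. K * norm ((\<Sum>i<n. f i) - s)) \<longlonglongrightarrow> K * norm (s - s)"
      using that(1) unfolding sums_def by (intro tendsto_intros)
    then have lim: "(\<lambda>n. K * norm ((\<Sum>i<n. f i) - s)) \<longlonglongrightarrow> 0" by simp
    have "cmod ((\<Sum>i<n. \<phi> (f i)) - \<phi> s) \<le> K * norm ((\<Sum>i<n. f i) - s)" for n
      using bound[of "(\<Sum>i<n. f i) - s"] that s by (simp add: sum[symmetric] diff sum_mem)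
    then have "(\<lambda>n. (\<Sum>i<n. \<phi> (f i)) - \<phi> s) \<longlonglongrightarrow> 0"
      by (intro Lim_null_comparison[OF _ lim]) auto
    then show ?thesis
      unfolding sums_def by (rule LIM_zero_cancel)
  qed
  define a where "a n = \<phi> (y ^ n) / fact n" for n
  define p where "p z = \<phi> (exp (const_bcontfun z * y))" for z
  have p_sums: "(\<lambda>n. a n * z ^ n) sums p z" for z
  proof -
    have "(const_bcontfun z * y) ^ n /\<^sub>R fact n = const_bcontfun (z ^ n / fact n) * y ^ n" for n
      by (rule bcontfun_eqI)
         (simp add: power_mult_distrib const_bcontfun_power[symmetric] scaleR_conv_of_real[where 'a = complex] field_simps)
    then have "(\<lambda>n. const_bcontfun (z ^ n / fact n) * y ^ n) sums exp (const_bcontfun z * y)"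
      using exp_converges[of "const_bcontfun z * y"] by simp
    from sums[OF this] have "(\<lambda>n. z ^ n / fact n * \<phi> (y ^ n)) sums p z"
      using y by (simp add: hom p_def)
    then show ?thesis
      by (simp add: a_def mult.commute)
  qed
  then have p_eq: "p = (\<lambda>z. \<Sum>n. a n * z ^ n)"
    using sums_unique by blast
  have deriv_p: "(p has_field_derivative (\<Sum>n. diffs a n * z ^ n)) (at z)" for z
    unfolding p_eq using p_sums sums_summable by (intro termdiffs_strong_converges_everywhere) blast
  have "K \<ge> 0" using bound[OF one_mem] one by simp
  have "p holomorphic_on UNIV"
    using deriv_p by (auto simp: holomorphic_on_def field_differentiable_def intro: has_field_derivative_at_within)
  moreover have "p z \<noteq> 0" for z
    using nz[of "const_bcontfun z * y"] y by (simp add: p_def)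
  moreover have "p 0 = 1" by (simp add: p_def one)
  moreover have "cmod (p z) \<le> (K + 1) * exp (norm y * cmod z)" for z
  proof -
    have "cmod (p z) \<le> K * norm (exp (const_bcontfun z * y))"
      unfolding p_def using y by (intro bound) auto
    also have "\<dots> \<le> K * exp (norm y * cmod z)"
      using norm_exp[of "const_bcontfun z * y"] \<open>K \<ge> 0\<close>
      by (intro mult_left_mono) (simp_all add: mult.commute[of "norm y"])
    also have "\<dots> \<le> (K + 1) * exp (norm y * cmod z)" by (intro mult_right_mono) auto
    finally show ?thesis .
  qed
  ultimately obtain \<alpha> where \<alpha>: "\<And>z. p z = exp (\<alpha> * z)"
    using entire_zero_free_exp[of p "K + 1" "norm y"] \<open>K \<ge> 0\<close> by auto
  have "(p has_field_derivative a 1) (at 0)"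
    using deriv_p[of 0] by (simp add: diffs_def)
  moreover have "(p has_field_derivative \<alpha>) (at 0)"
    unfolding \<alpha>[abs_def] by (auto intro!: derivative_eq_intros)
  ultimately have "\<alpha> = \<phi> y"
    using DERIV_unique by (force simp: a_def)
  then show ?thesis
    using \<alpha>[of 1] by (simp add: p_def const_bcontfun_1)
qed

text \<open>\<open>\<phi>\<close> is the complex linear functional with the same real part as the
  real linear map \<open>L\<close>. It inherits nonvanishing at exponentials, so
  \<open>linear_functional_exp\<close> applies to it.\<close>

lemma complexification_exp:
  assumes add: "\<forall>f\<in>A. \<forall>g\<in>A. L (f + g) = L f + L g"
    and real: "\<forall>r. \<forall>f\<in>A. L (r *\<^sub>R f) = of_real r * L f"
    and bound: "\<forall>f\<in>A. cmod (L f) \<le> norm f"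
    and const: "\<forall>c. L (const_bcontfun c) = c"
    and nz: "\<forall>c f. f \<in> A \<longrightarrow> c \<noteq> 0 \<longrightarrow> L (const_bcontfun c * exp f) \<noteq> 0"
  defines "\<phi> \<equiv> \<lambda>f. of_real (Re (L f)) - \<i> * of_real (Re (L (const_bcontfun \<i> * f)))"
  shows "f \<in> A \<Longrightarrow> g \<in> A \<Longrightarrow> \<phi> (f + g) = \<phi> f + \<phi> g"
    and "f \<in> A \<Longrightarrow> \<phi> (const_bcontfun c * f) = c * \<phi> f"
    and "\<phi> 1 = 1"
    and "f \<in> A \<Longrightarrow> \<phi> (exp f) = exp (\<phi> f)"
proof -
  show 1: "\<phi> (f + g) = \<phi> f + \<phi> g" if "f \<in> A" "g \<in> A" for f g
    using that by (simp add: \<phi>_def add distrib_left algebra_simps)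
  have decomp: "const_bcontfun c * f = Re c *\<^sub>R f + Im c *\<^sub>R (const_bcontfun \<i> * f)" for c f
    by (rule bcontfun_eqI) (simp add: complex_eq_iff)
  have Lc: "L (const_bcontfun c * f) = of_real (Re c) * L f + of_real (Im c) * L (const_bcontfun \<i> * f)"
    if "f \<in> A" for c f
    unfolding decomp[of c f] using that by (simp add: add real)
  show 2: "\<phi> (const_bcontfun c * f) = c * \<phi> f" if "f \<in> A" for c f
  proof -
    have "const_bcontfun \<i> * (const_bcontfun c * f) = const_bcontfun (\<i> * c) * f"
      by (simp add: const_bcontfun_mult mult.assoc)
    then show ?thesis
      using Lc[OF that, of c] Lc[OF that, of "\<i> * c"] by (simp add: \<phi>_def complex_eq_iff)
  qed
  show 3: "\<phi> 1 = 1"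
    using const[rule_format, of 1] const[rule_format, of \<i>] by (simp add: \<phi>_def const_bcontfun_1)
  show "\<phi> (exp f) = exp (\<phi> f)" if "f \<in> A" for f
  proof (rule linear_functional_exp[where K = 2, OF 1 2 _ 3 _ that])
    fix g assume g: "g \<in> A"
    have "cmod (\<phi> g) \<le> cmod (of_real (Re (L g))) + cmod (\<i> * of_real (Re (L (const_bcontfun \<i> * g))))"
      unfolding \<phi>_def by (rule norm_triangle_ineq4)
    also have "\<dots> \<le> cmod (L g) + cmod (L (const_bcontfun \<i> * g))"
      by (simp add: norm_mult abs_Re_le_cmod add_mono)
    also have "\<dots> \<le> 2 * norm g"
      using bound[rule_format, OF g] bound[rule_format, of "const_bcontfun \<i> * g"] g by simp
    finally show "cmod (\<phi> g) \<le> 2 * norm g" .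
    show "\<phi> (exp g) \<noteq> 0"
    proof
      assume "\<phi> (exp g) = 0"
      then have "Re (L (exp g)) = 0" "Re (L (const_bcontfun \<i> * exp g)) = 0"
        by (auto simp: \<phi>_def complex_eq_iff)
      moreover define s t where "s = Im (L (exp g))" and "t = Im (L (const_bcontfun \<i> * exp g))"
      ultimately have L: "L (exp g) = \<i> * s" "L (const_bcontfun \<i> * exp g) = \<i> * t"
        by (auto simp: complex_eq_iff)
      \<comment> \<open>On multiples of \<open>exp g\<close> the real linear map \<open>L\<close> takes values in a real line, so it has a kernel.\<close>
      show False
      proof (cases "s = 0")
        case True
        then show ?thesis using L nz[rule_format, OF g, of 1] by (simp add: const_bcontfun_1)
      next
        case False
        then have "L (const_bcontfun (Complex t (- s)) * exp g) = 0"
          using Lc[of "exp g" "Complex t (- s)"] g by (simp add: L)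
        moreover have "Complex t (- s) \<noteq> 0" using False by (simp add: complex_eq_iff)
        ultimately show ?thesis using nz g by blast
      qed
    qed
  qed auto
qed

text \<open>\<open>L\<close> takes its real part from one complex linear functional
  \<open>\<phi>\<close> and its imaginary part from another one \<open>\<psi>\<close>, both
  compatible with \<open>exp\<close>. If they differed, \<open>L\<close> would vanish at some
  exponential.\<close>

lemma additive_admissible_homogeneous:
  assumes L: "L \<in> admissible"
    and add: "\<And>f g. f \<in> A \<Longrightarrow> g \<in> A \<Longrightarrow> L (f + g) = L f + L g"
    and f: "f \<in> A"
  shows "L (const_bcontfun c * f) = c * L f"
proof -
  have bound: "cmod (L f) \<le> norm f" for f by (rule admissible_norm[OF L])
  have real: "L (r *\<^sub>R f) = of_real r * L f" if "f \<in> A" for r f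
  proof -
    have "L (r *\<^sub>R f) = r *\<^sub>R L (1 *\<^sub>R f)"
    proof (rule additive_linear_bound)
      show "L ((s + t) *\<^sub>R f) = L (s *\<^sub>R f) + L (t *\<^sub>R f)" for s t
        using that by (simp add: scaleR_add_left add)
      show "cmod (L (t *\<^sub>R f)) \<le> norm f * \<bar>t\<bar>" for t
        using bound[of "t *\<^sub>R f"] by (simp add: mult.commute)
    qed
    then show ?thesis by (simp add: scaleR_conv_of_real[where 'a = complex])
  qed
  have const: "L (const_bcontfun c) = c" for c
    using admissible_const[OF L, of 0 c] admissible_0[OF L] by simp
  have nz: "L (const_bcontfun c * exp f) \<noteq> 0" if "f \<in> A" "c \<noteq> 0" for c f
    using admissible_exp[OF L, of 0 f c] admissible_0[OF L] that by auto
  let ?i = "const_bcontfun \<i>"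
  have ii: "?i * (?i * f) = (-1) *\<^sub>R f" for f :: "'k \<Rightarrow>\<^sub>C complex"
    by (rule bcontfun_eqI) (simp add: complex_eq_iff)
  define \<phi> where "\<phi> f = of_real (Re (L f)) - \<i> * of_real (Re (L (?i * f)))" for f
  have 1: "\<forall>f\<in>A. \<forall>g\<in>A. L (f + g) = L f + L g" by (intro ballI add)
  have 2: "\<forall>r. \<forall>f\<in>A. L (r *\<^sub>R f) = of_real r * L f" by (intro allI ballI real)
  have 3: "\<forall>f\<in>A. cmod (L f) \<le> norm f" by (intro ballI bound)
  have 4: "\<forall>c. L (const_bcontfun c) = c" by (intro allI const)
  have 5: "\<forall>c f. f \<in> A \<longrightarrow> c \<noteq> 0 \<longrightarrow> L (const_bcontfun c * exp f) \<noteq> 0"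
    by (intro allI impI nz)
  note \<phi> = complexification_exp[of L, OF 1 2 3 4 5, folded \<phi>_def]
  \<comment> \<open>\<open>L'\<close> has the properties of \<open>L\<close> used so far, and its
    complexification \<open>\<psi>\<close> has the imaginary part of \<open>L\<close>.\<close>
  define L' where "L' f = - \<i> * L (?i * f)" for f
  define \<psi> where "\<psi> f = of_real (Re (L' f)) - \<i> * of_real (Re (L' (?i * f)))" for f
  have 1: "\<forall>f\<in>A. \<forall>g\<in>A. L' (f + g) = L' f + L' g"
    using add by (simp add: L'_def distrib_left)
  have 2: "\<forall>r. \<forall>f\<in>A. L' (r *\<^sub>R f) = of_real r * L' f"
    using real[of "?i * _"] by (simp add: L'_def)
  have 3: "\<forall>f\<in>A. cmod (L' f) \<le> norm f"
    using bound[of "?i * _"] by (simp add: L'_def norm_mult)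
  have 4: "\<forall>c. L' (const_bcontfun c) = c"
    by (simp add: L'_def const_bcontfun_mult[symmetric] const)
  have 5: "\<forall>c f. f \<in> A \<longrightarrow> c \<noteq> 0 \<longrightarrow> L' (const_bcontfun c * exp f) \<noteq> 0"
    using nz[of _ "\<i> * _"] by (simp add: L'_def const_bcontfun_mult mult.assoc)
  note \<psi> = complexification_exp[of L', OF 1 2 3 4 5, folded \<psi>_def]
  have Re_L: "Re (L f) = Re (\<phi> f)" for f by (simp add: \<phi>_def)
  have Im_L: "Im (L f) = Im (\<psi> f)" if "f \<in> A" for f
    using real[OF that, of "-1"] by (simp add: \<psi>_def L'_def ii)
  have eq: "\<phi> g = \<psi> g" if g: "g \<in> A" for g
  proof (rule ccontr)
    assume ne: "\<phi> g \<noteq> \<psi> g"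
    \<comment> \<open>Normalise so that \<open>\<phi> h = \<i> * pi / 2\<close> and \<open>\<psi> h = 0\<close>; then \<open>L (exp h) = Re \<i> + \<i> * Im 1 = 0\<close>.\<close>
    define h where "h = const_bcontfun (\<i> * pi / 2 / (\<phi> g - \<psi> g)) * (g + const_bcontfun (- \<psi> g) * 1)"
    have h: "h \<in> A" using g by (auto simp: h_def)
    have 1: "const_bcontfun (- \<psi> g) * 1 \<in> A" by blast
    have 2: "g + const_bcontfun (- \<psi> g) * 1 \<in> A" using g 1 by blast
    have cancel: "a / d * d = a" if "d \<noteq> 0" for a d :: complex
      using that by simp
    have "\<phi> h = \<i> * pi / 2 / (\<phi> g - \<psi> g) * (\<phi> g - \<psi> g)"
      unfolding h_def \<phi>(2)[OF 2] \<phi>(1)[OF g 1] \<phi>(2)[OF one_mem] \<phi>(3) by simp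
    moreover have "\<psi> h = 0"
      unfolding h_def \<psi>(2)[OF 2] \<psi>(1)[OF g 1] \<psi>(2)[OF one_mem] \<psi>(3) by simp
    ultimately have h_vals: "\<phi> h = \<i> * pi / 2" "\<psi> h = 0"
      using cancel[of "\<phi> g - \<psi> g" "\<i> * pi / 2"] ne by (metis right_minus_eq)+
    have "exp (\<phi> h) = \<i>"
      unfolding h_vals using cis_conv_exp[of "pi / 2"] by simp
    then have "L (exp h) = 0"
      using Re_L[of "exp h"] Im_L[of "exp h"] \<phi>(4)[OF h] \<psi>(4)[OF h] h h_vals(2) by (intro complex_eqI) simp_all
    then show False
      using nz[OF h, of 1] by (simp add: const_bcontfun_1)
  qed
  have "L g = \<phi> g" if "g \<in> A" for g
    using Re_L[of g] Im_L[OF that] eq[OF that] by (simp add: complex_eq_iff)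
  then show ?thesis
    using \<phi>(2)[OF f] f by simp
qed

end

subsection \<open>Contour integrals over parallelograms\<close>

abbreviation CI :: "(complex \<Rightarrow> complex) \<Rightarrow> complex \<Rightarrow> complex \<Rightarrow> complex" where
  "CI F p q \<equiv> contour_integral (linepath p q) F"

lemma has_CI: "continuous_on UNIV F \<Longrightarrow> (F has_contour_integral CI F p q) (linepath p q)"
  by (meson contour_integrable_continuous_linepath continuous_on_subset has_contour_integral_integral subset_UNIV)

lemma CI_affine:
  assumes F: "continuous_on UNIV F"
  shows "u * CI (\<lambda>t. F (u * t + v)) p q = CI F (u * p + v) (u * q + v)"
proof -
  have G: "continuous_on UNIV (\<lambda>t. F (u * t + v))"
    by (intro continuous_on_compose2[OF F] continuous_intros) auto
  have "((\<lambda>x. F (u * linepath p q x + v) * (q - p)) has_integral CI (\<lambda>t. F (u * t + v)) p q) {0..1}"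
    using has_CI[OF G, of p q] by (simp add: has_contour_integral_linepath)
  then have "((\<lambda>x. u * (F (u * linepath p q x + v) * (q - p))) has_integral u * CI (\<lambda>t. F (u * t + v)) p q) {0..1}"
    by (rule has_integral_mult_right)
  moreover have "u * (F (u * linepath p q x + v) * (q - p))
      = F (linepath (u * p + v) (u * q + v) x) * ((u * q + v) - (u * p + v))" for x
  proof -
    have "u * linepath p q x + v = linepath (u * p + v) (u * q + v) x"
      by (simp add: linepath_def scaleR_conv_of_real algebra_simps)
    then show ?thesis by (simp add: algebra_simps)
  qed
  ultimately have "(F has_contour_integral u * CI (\<lambda>t. F (u * t + v)) p q) (linepath (u * p + v) (u * q + v))"
    by (simp add: has_contour_integral_linepath)
  then show ?thesis
    by (simp add: contour_integral_unique)
qed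

lemma CI_translate:
  "continuous_on UNIV F \<Longrightarrow> CI (\<lambda>t. F (v + t)) p q = CI F (v + p) (v + q)"
  using CI_affine[of F 1 p q v] by (simp add: add.commute)

lemma CI_minus_const:
  assumes "continuous_on UNIV F"
  shows "CI (\<lambda>t. F t - k) p q = CI F p q - k * (q - p)"
  by (rule contour_integral_unique[OF has_contour_integral_diff[OF has_CI[OF assms] has_contour_integral_const_linepath]])

lemma CI_midpoint:
  assumes "continuous_on UNIV F"
  shows "CI F p q = CI F p ((p + q) / 2) + CI F ((p + q) / 2) q"
proof (rule contour_integral_split_linepath)
  show "(p + q) / 2 \<in> closed_segment p q"
    by (metis midpoint_def midpoint_in_closed_segment scaleR_conv_of_real of_real_inverse of_real_numeral
        divide_inverse mult.commute)
qed (use assms continuous_on_subset in blast)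

lemma CI_reverse: "CI F q p = - CI F p q"
  by (metis contour_integral_reversepath reversepath_linepath valid_path_linepath)

lemma CI_bound:
  assumes F: "continuous_on UNIV F" and le: "\<And>z. z \<in> closed_segment p q \<Longrightarrow> cmod (F z) \<le> B"
  shows "cmod (CI F p q) \<le> B * cmod (q - p)"
proof (rule contour_integral_bound_linepath)
  show "0 \<le> B" using order_trans[OF norm_ge_zero le[of p]] by simp
qed (use assms in \<open>auto intro!: contour_integrable_continuous_linepath intro: continuous_on_subset\<close>)

lemma CI_cmult:
  assumes "continuous_on UNIV F"
  shows "CI (\<lambda>t. k * F t) p q = k * CI F p q"
  by (rule contour_integral_unique[OF has_contour_integral_lmul[OF has_CI[OF assms]]])

definition par_integral :: "(complex \<Rightarrow> complex) \<Rightarrow> complex \<Rightarrow> complex \<Rightarrow> complex" where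
  "par_integral F a b = CI F 0 a + CI F a (a + b) + CI F (a + b) b + CI F b 0"

lemma par_integral_minus_const:
  "continuous_on UNIV F \<Longrightarrow> par_integral (\<lambda>t. F t - k) a b = par_integral F a b"
  by (simp add: par_integral_def CI_minus_const algebra_simps)

text \<open>The parallelogram is tiled by four half-size copies and the integrals along interior
  edges cancel. One factor 2 stands in the integrand, the other comes from the substitution.\<close>

lemma par_integral_subdivide:
  assumes F: "continuous_on UNIV F"
  shows "(\<Sum>\<tau>\<leftarrow>[0, a, b, a + b]. par_integral (\<lambda>t. 2 * F ((\<tau> + t) / 2)) a b) = 4 * par_integral F a b"
proof -
  have eq: "CI (\<lambda>t. 2 * F ((\<tau> + t) / 2)) p q = 4 * CI F ((\<tau> + p) / 2) ((\<tau> + q) / 2)" for \<tau> p q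
  proof -
    have G: "continuous_on UNIV (\<lambda>t. F ((\<tau> + t) / 2))"
      by (intro continuous_on_compose2[OF F] continuous_intros) auto
    show ?thesis
      using CI_affine[OF F, of "1/2" p q "\<tau> / 2"] CI_cmult[OF G, where k = 2 and p = p and q = q]
      by (simp add: add_divide_distrib add.commute)
  qed
  \<comment> \<open>The nine grid points of the subdivision, for \<open>i\<close> and
    \<open>j\<close> up to 2.\<close>
  define P where "P i j = (of_nat i * a + of_nat j * b) / 2" for i j
  let ?I = "\<lambda>\<tau>. par_integral (\<lambda>t. 2 * F ((\<tau> + t) / 2)) a b"
  have tile: "?I (of_nat i * a + of_nat j * b) = 4 * (CI F (P i j) (P (Suc i) j)
      + CI F (P (Suc i) j) (P (Suc i) (Suc j)) - CI F (P i (Suc j)) (P (Suc i) (Suc j)) - CI F (P i j) (P i (Suc j)))" for i j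
    unfolding par_integral_def eq CI_reverse[of "P i (Suc j)" "P (Suc i) (Suc j)", symmetric]
      diff_conv_add_uminus CI_reverse[of "P i j" "P i (Suc j)", symmetric]
    by (simp add: P_def algebra_simps CI_reverse[symmetric])
  have big: "par_integral F a b = (CI F (P 0 0) (P 1 0) + CI F (P 1 0) (P 2 0))
      + (CI F (P 2 0) (P 2 1) + CI F (P 2 1) (P 2 2))
      - (CI F (P 0 2) (P 1 2) + CI F (P 1 2) (P 2 2)) - (CI F (P 0 0) (P 0 1) + CI F (P 0 1) (P 0 2))"
  proof -
    have pts: "P 0 0 = 0" "P 2 0 = a" "P 0 2 = b" "P 2 2 = a + b" "P 1 0 = (0 + a) / 2" "P 0 1 = (0 + b) / 2"
      "P 2 1 = (a + (a + b)) / 2" "P 1 2 = (b + (a + b)) / 2"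
      by (simp_all add: P_def field_simps)
    have "CI F (P 0 0) (P 1 0) + CI F (P 1 0) (P 2 0) = CI F 0 a"
      "CI F (P 2 0) (P 2 1) + CI F (P 2 1) (P 2 2) = CI F a (a + b)"
      "CI F (P 0 2) (P 1 2) + CI F (P 1 2) (P 2 2) = CI F b (a + b)"
      "CI F (P 0 0) (P 0 1) + CI F (P 0 1) (P 0 2) = CI F 0 b"
      unfolding pts by (rule CI_midpoint[OF F, symmetric])+
    then show ?thesis
      by (simp add: par_integral_def CI_reverse[of b "a + b"] CI_reverse[of 0 b])
  qed
  show ?thesis
    using tile[of 0 0] tile[of 1 0] tile[of 0 1] tile[of 1 1]
    by (simp add: numeral_2_eq_2 big)
qed

text \<open>Once integrals over triangles vanish, Morera's theorem makes \<open>F\<close> entire,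
  and an entire function of at most linear growth is affine.\<close>

lemma Lipschitz_parallelograms_affine:
  assumes lip: "\<And>s t. cmod (F s - F t) \<le> K * cmod (s - t)"
    and par: "\<And>v a b. par_integral (\<lambda>t. F (v + t)) a b = 0"
  shows "\<exists>k. \<forall>t. F t = F 0 + t * k"
proof -
  have "K \<ge> 0" using order_trans[OF norm_ge_zero lip[of 0 1]] by simp
  have cont: "continuous_on S F" for S
    using lip \<open>K \<ge> 0\<close> by (intro lipschitz_on_continuous_on[of K]) (auto simp: lipschitz_on_def dist_norm)
  have cont': "continuous_on UNIV (\<lambda>t. F (v + t))" for v
    by (intro continuous_on_compose2[OF cont] continuous_intros) auto
  define tri where "tri v a b = CI F v (v + a) + CI F (v + a) (v + b) + CI F (v + b) v" for v a b
  \<comment> \<open>A triangle consists of a parallelogram and two half-size triangles, so the integral over it is at most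
    half of what the Lipschitz bound gives, and iterating shows that it is \<open>0\<close>.\<close>
  have halve: "tri v a b = tri (v + a / 2) (a / 2) (b / 2) + tri (v + b / 2) (a / 2) (b / 2)" for v a b
  proof -
    have "0 = CI F v (v + a / 2) + CI F (v + a / 2) (v + (a / 2 + b / 2))
        + CI F (v + (a / 2 + b / 2)) (v + b / 2) + CI F (v + b / 2) v"
      using par[of v "a / 2" "b / 2"] by (simp add: par_integral_def CI_translate[OF cont])
    moreover have "CI F v (v + a) = CI F v (v + a / 2) + CI F (v + a / 2) (v + a)"
      using CI_midpoint[OF cont, of v "v + a"] by (simp add: field_simps)
    moreover have "CI F (v + b) v = CI F (v + b) (v + b / 2) + CI F (v + b / 2) v"
      using CI_midpoint[OF cont, of "v + b" v] by (simp add: field_simps)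
    moreover have "CI F (v + a) (v + b) = CI F (v + a) (v + (a / 2 + b / 2)) + CI F (v + (a / 2 + b / 2)) (v + b)"
      using CI_midpoint[OF cont, of "v + a" "v + b"] by (simp add: field_simps)
    moreover have "CI F (v + (a / 2 + b / 2)) (v + a / 2) = - CI F (v + a / 2) (v + (a / 2 + b / 2))"
      "CI F (v + b / 2) (v + (a / 2 + b / 2)) = - CI F (v + (a / 2 + b / 2)) (v + b / 2)"
      by (rule CI_reverse)+
    moreover have "v + a / 2 + a / 2 = v + a" "v + b / 2 + b / 2 = v + b"
      "v + a / 2 + b / 2 = v + (a / 2 + b / 2)" "v + b / 2 + a / 2 = v + (a / 2 + b / 2)"
      by (simp_all add: field_simps)
    ultimately show ?thesis
      unfolding tri_def by (simp only:) (simp add: algebra_simps)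
  qed
  have bound: "cmod (tri v a b) \<le> 2 * K * (cmod a + cmod b)\<^sup>2 / 2 ^ n" for v a b n
  proof (induction n arbitrary: v a b)
    case 0
    define R where "R = cmod a + cmod b"
    have "0 \<le> R" by (simp add: R_def)
    \<comment> \<open>Subtracting the constant \<open>F v\<close> does not change the integral over
      a closed path and makes the integrand at most \<open>K * R\<close> on the triangle.\<close>
    have G: "continuous_on UNIV (\<lambda>t. F t - F v)" by (intro continuous_intros cont)
    have edge: "cmod (CI (\<lambda>t. F t - F v) p q) \<le> K * R * cmod (q - p)"
      if "cmod (p - v) \<le> R" "cmod (q - v) \<le> R" for p q
    proof (rule CI_bound[OF G])
      fix z assume "z \<in> closed_segment p q"
      then have "z \<in> cball v R"
        using that closed_segment_subset[OF _ _ convex_cball, of p v R q]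
        by (auto simp: dist_norm norm_minus_commute)
      then have "K * cmod (z - v) \<le> K * R"
        using \<open>K \<ge> 0\<close> by (intro mult_left_mono) (auto simp: dist_norm norm_minus_commute)
      then show "cmod (F z - F v) \<le> K * R" using lip[of z v] by linarith
    qed
    have "tri v a b = CI (\<lambda>t. F t - F v) v (v + a) + CI (\<lambda>t. F t - F v) (v + a) (v + b)
        + CI (\<lambda>t. F t - F v) (v + b) v"
      by (simp add: tri_def CI_minus_const[OF cont] algebra_simps)
    then have "cmod (tri v a b) \<le> cmod (CI (\<lambda>t. F t - F v) v (v + a))
        + cmod (CI (\<lambda>t. F t - F v) (v + a) (v + b)) + cmod (CI (\<lambda>t. F t - F v) (v + b) v)"
      using norm_triangle_mono norm_triangle_ineq order_refl by metis
    also have "\<dots> \<le> K * R * cmod a + K * R * cmod (b - a) + K * R * cmod b"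
      using edge[of v "v + a"] edge[of "v + a" "v + b"] edge[of "v + b" v] by (simp add: R_def)
    also have "\<dots> \<le> K * R * (2 * R)"
      using norm_triangle_ineq4[of b a] \<open>0 \<le> K\<close> \<open>0 \<le> R\<close>
      unfolding distrib_left[symmetric] by (intro mult_left_mono) (auto simp: R_def)
    finally show ?case by (simp add: R_def power2_eq_square algebra_simps)
  next
    case (Suc n)
    have "cmod (tri v a b) \<le> cmod (tri (v + a / 2) (a / 2) (b / 2)) + cmod (tri (v + b / 2) (a / 2) (b / 2))"
      unfolding halve[of v a b] by (rule norm_triangle_ineq)
    also have "\<dots> \<le> 2 * (2 * K * (cmod (a / 2) + cmod (b / 2))\<^sup>2 / 2 ^ n)"
      using Suc.IH[of "v + a / 2" "a / 2" "b / 2"] Suc.IH[of "v + b / 2" "a / 2" "b / 2"] by simp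
    also have "\<dots> = 2 * K * (cmod a + cmod b)\<^sup>2 / 2 ^ Suc n"
      by (simp add: norm_divide power2_eq_square field_simps)
    finally show ?case .
  qed
  have tri_0: "tri v a b = 0" for v a b
  proof -
    have "(\<lambda>n. (2 * K * (cmod a + cmod b)\<^sup>2) * (1/2) ^ n) \<longlonglongrightarrow> (2 * K * (cmod a + cmod b)\<^sup>2) * 0"
      by (intro tendsto_intros LIMSEQ_realpow_zero) auto
    moreover have "\<forall>n\<ge>0. cmod (tri v a b) \<le> (2 * K * (cmod a + cmod b)\<^sup>2) * (1/2) ^ n"
      using bound[of v a b] by (simp add: power_one_over field_simps)
    ultimately have "cmod (tri v a b) \<le> 0"
      using LIMSEQ_le_const by fastforce
    then show ?thesis by simp
  qed
  have "F analytic_on UNIV"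
  proof (rule Morera_triangle[OF cont open_UNIV], intro impI)
    show "CI F a b + CI F b c + CI F c a = 0" for a b c
      using tri_0[of a "b - a" "c - a"] by (simp add: tri_def)
  qed
  then have hol: "F holomorphic_on UNIV" by (simp add: analytic_imp_holomorphic)
  have growth: "cmod (F z) \<le> (cmod (F 0) + K) * cmod z ^ 1" if "1 \<le> cmod z" for z
  proof -
    have "cmod (F z) \<le> cmod (F 0) + K * cmod z"
      using norm_triangle_ineq2[of "F z" "F 0"] lip[of z 0] by simp
    moreover have "cmod (F 0) * 1 \<le> cmod (F 0) * cmod z"
      using that by (intro mult_left_mono) auto
    ultimately show ?thesis by (simp add: algebra_simps)
  qed
  have "F z = F 0 + z * deriv F 0" for z
  proof -
    have "F z = (\<Sum>k\<le>1. (deriv ^^ k) F 0 / fact k * z ^ k)"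
      by (rule Liouville_polynomial[OF hol growth])
    also have "\<dots> = F 0 + z * deriv F 0"
      by (simp add: mult.commute)
    finally show ?thesis .
  qed
  then show ?thesis by blast
qed

text \<open>The error bound depends on \<open>F\<close> only through the Lipschitz constant, so it
  is uniform over \<open>admissible\<close>.\<close>

lemma CI_riemann:
  fixes p q :: complex
  assumes lip: "\<And>s t. cmod (F s - F t) \<le> K * cmod (s - t)" and n: "0 < n"
  defines "\<delta> \<equiv> (q - p) / of_nat n"
  shows "cmod (CI F p q - (\<Sum>j<n. F (p + of_nat j * \<delta>) * \<delta>)) \<le> K * (cmod (q - p))\<^sup>2 / real n"
proof -
  have "K \<ge> 0" using order_trans[OF norm_ge_zero lip[of 0 1]] by simp
  have cont: "continuous_on S F" for S
    using lip \<open>K \<ge> 0\<close> by (intro lipschitz_on_continuous_on[of K]) (auto simp: lipschitz_on_def dist_norm)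
  have split: "CI F p (p + of_nat m * \<delta>) = (\<Sum>j<m. CI F (p + of_nat j * \<delta>) (p + of_nat j * \<delta> + \<delta>))" for m
  proof (induction m)
    case 0
    have "CI F p p = 0" by (rule contour_integral_unique) (rule has_contour_integral_trivial)
    then show ?case by (simp only: of_nat_0 mult_zero_left add_0_right lessThan_0 sum.empty)
  next
    case (Suc m)
    have "p + of_nat m * \<delta> \<in> closed_segment p (p + of_nat (Suc m) * \<delta>)"
      unfolding in_segment
    proof (intro exI[of _ "real m / real (Suc m)"] conjI)
      have "of_nat m / of_nat (Suc m) * of_nat (Suc m) = (of_nat m :: complex)"
        by (simp del: of_nat_Suc)
      then show "p + of_nat m * \<delta> = (1 - real m / real (Suc m)) *\<^sub>R p
          + (real m / real (Suc m)) *\<^sub>R (p + of_nat (Suc m) * \<delta>)"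
        by (simp add: scaleR_conv_of_real algebra_simps del: of_nat_Suc)
    qed auto
    from contour_integral_split_linepath[OF cont this] show ?case
      using Suc.IH by (simp add: algebra_simps)
  qed
  have step: "cmod (CI F r (r + \<delta>) - F r * \<delta>) \<le> K * (cmod \<delta>)\<^sup>2" for r
  proof -
    have "cmod (CI (\<lambda>t. F t - F r) r (r + \<delta>)) \<le> K * cmod \<delta> * cmod (r + \<delta> - r)"
    proof (rule CI_bound)
      show "continuous_on UNIV (\<lambda>t. F t - F r)" by (intro continuous_intros cont)
      fix z assume z: "z \<in> closed_segment r (r + \<delta>)"
      then have "cmod (z - r) \<le> cmod \<delta>"
        using segment_bound1[OF z] by simp
      then show "cmod (F z - F r) \<le> K * cmod \<delta>"
        using lip[of z r] \<open>K \<ge> 0\<close> by (meson mult_left_mono order_trans)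
    qed
    then show ?thesis
      by (simp add: CI_minus_const[OF cont] power2_eq_square mult.assoc)
  qed
  have q: "q = p + of_nat n * \<delta>" using n by (simp add: \<delta>_def)
  have "CI F p q - (\<Sum>j<n. F (p + of_nat j * \<delta>) * \<delta>)
      = (\<Sum>j<n. CI F (p + of_nat j * \<delta>) (p + of_nat j * \<delta> + \<delta>) - F (p + of_nat j * \<delta>) * \<delta>)"
    unfolding sum_subtractf split[of n, symmetric] q[symmetric] ..
  also have "cmod \<dots> \<le> (\<Sum>j<n. K * (cmod \<delta>)\<^sup>2)"
    by (rule sum_norm_le) (rule step)
  also have "\<dots> = K * (cmod (q - p))\<^sup>2 / real n"
    using n by (simp add: \<delta>_def norm_divide power2_eq_square)
  finally show ?thesis .
qed

section \<open>Admissible functions along complex lines\<close>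

context function_algebra
begin

lemma admissible_line_lipschitz:
  assumes "D \<in> admissible" "x \<in> A"
  shows "cmod (D (const_bcontfun s * x) - D (const_bcontfun t * x)) \<le> norm x * cmod (s - t)"
proof -
  have "const_bcontfun s * x - const_bcontfun t * x = const_bcontfun (s - t) * x"
    by (simp add: const_bcontfun_diff algebra_simps)
  then show ?thesis
    using admissible_lipschitz[OF assms(1), of "const_bcontfun s * x" "const_bcontfun t * x"] assms(2)
    by (simp add: mult.commute[of "norm x"])
qed

lemma continuous_on_line:
  assumes "D \<in> admissible" "x \<in> A"
  shows "continuous_on S (\<lambda>t. D (const_bcontfun t * x))"
  using admissible_line_lipschitz[OF assms]
  by (intro lipschitz_on_continuous_on[of "norm x"]) (auto simp: lipschitz_on_def dist_norm)

text \<open>A uniform limit of Riemann sums, each of which depends on finitely many values of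
  \<open>D\<close> and so is continuous for pointwise convergence.\<close>

lemma continuous_on_CI:
  assumes x: "x \<in> A"
  shows "continuous_on admissible (\<lambda>D. CI (\<lambda>t. D (const_bcontfun t * x)) p q)"
proof -
  define R where "R n D = (\<Sum>j<n. D (const_bcontfun (p + of_nat j * ((q - p) / of_nat n)) * x) * ((q - p) / of_nat n))"
    for n and D :: "('k \<Rightarrow>\<^sub>C complex) \<Rightarrow> complex"
  have "uniform_limit admissible R (\<lambda>D. CI (\<lambda>t. D (const_bcontfun t * x)) p q) sequentially"
  proof (rule uniform_limitI)
    fix e :: real assume "0 < e"
    obtain N where N: "norm x * (cmod (q - p))\<^sup>2 < real N * e"
      using reals_Archimedean3[OF \<open>0 < e\<close>] by blast
    show "\<forall>\<^sub>F n in sequentially. \<forall>D\<in>admissible. dist (R n D) (CI (\<lambda>t. D (const_bcontfun t * x)) p q) < e"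
      using eventually_ge_at_top[of "Suc N"]
    proof eventually_elim
      case (elim n)
      show ?case
      proof
        fix D assume D: "D \<in> admissible"
        have "real N * e \<le> real n * e" using elim \<open>0 < e\<close> by (intro mult_right_mono) auto
        then have "norm x * (cmod (q - p))\<^sup>2 / real n < e"
          using N elim by (simp add: divide_less_eq mult.commute)
        then show "dist (R n D) (CI (\<lambda>t. D (const_bcontfun t * x)) p q) < e"
          using CI_riemann[where F = "\<lambda>t. D (const_bcontfun t * x)" and n = n and p = p and q = q,
              OF admissible_line_lipschitz[OF D x]] elim
          by (simp add: R_def dist_norm norm_minus_commute)
      qed
    qed
  qed
  moreover have "continuous_on admissible (R n)" for n
    unfolding R_def
    by (intro continuous_on_sum continuous_on_mult continuous_on_const
        continuous_on_subset[OF continuous_on_product_coordinates]) auto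
  ultimately show ?thesis
    by (intro uniform_limit_theorem[where F = sequentially]) auto
qed

lemma admissible_par_integral:
  assumes D: "D \<in> admissible" and x: "x \<in> A"
  shows "par_integral (\<lambda>t. D (const_bcontfun t * x)) a b = 0"
proof -
  define F where "F D t = D (const_bcontfun t * x)" for D :: "('k \<Rightarrow>\<^sub>C complex) \<Rightarrow> complex" and t
  have contF: "continuous_on S (F D)" if "D \<in> admissible" for D S
    unfolding F_def[abs_def] by (rule continuous_on_line[OF that x])
  have F_tr: "F (tr (const_bcontfun \<tau> * x) D) = (\<lambda>t. F D (\<tau> + t) - D (const_bcontfun \<tau> * x))" for D \<tau>
    using x by (simp add: F_def fun_eq_iff const_bcontfun_add distrib_right)
  have F_dbl: "F (dbl D) = (\<lambda>t. 2 * F D (t / 2))" for D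
  proof -
    have "(1/2) *\<^sub>R (const_bcontfun t * x) = const_bcontfun (t / 2) * x" for t
      by (rule bcontfun_eqI) (simp add: scaleR_conv_of_real[where 'a = complex])
    then show ?thesis by (simp add: F_def dbl_def fun_eq_iff)
  qed
  have inv: "invariant admissible"
    using D by (auto simp: invariant_def closed_admissible dbl_admissible tr_admissible)
  \<comment> \<open>A minimal invariant set inside the set of maximisers consists of complex linear functions, at which the
    contour integral vanishes; so its maximum is \<open>0\<close>.\<close>
  have le_0: "Re (c * par_integral (F D) a b) \<le> 0" for c
  proof -
    let ?V = "\<lambda>D. Re (c * par_integral (F D) a b)"
    \<comment> \<open>The offsets of the four tiles in \<open>par_integral_subdivide\<close>, after
      magnification.\<close>
    define p where "p k = const_bcontfun ([0, a, b, a + b] ! k) * x" for k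
    obtain C' m where C': "invariant C'" "C' \<subseteq> admissible"
      "\<And>D y. D \<in> C' \<Longrightarrow> y \<in> A \<Longrightarrow> ?V (tr y D) = m" "\<And>D. D \<in> admissible \<Longrightarrow> ?V D \<le> m"
    proof (rule maximizing_invariant[OF inv, of ?V "cmod c * (4 * (cmod a + cmod b))" 4 p])
      show "continuous_on admissible ?V"
        unfolding par_integral_def F_def[abs_def]
        by (intro continuous_intros continuous_on_CI x)
      show "p k \<in> A" if "k < 4" for k using x by (auto simp: p_def)
      show "p 0 = 0" by (simp add: p_def)
      show "\<bar>?V (tr z D) - ?V D\<bar> \<le> cmod c * (4 * (cmod a + cmod b)) * norm z"
        if D: "D \<in> admissible" and z: "z \<in> A" for D z
      proof -
        \<comment> \<open>\<open>H\<close> is bounded by \<open>2 * norm z\<close> and the perimeter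
          is \<open>2 * (cmod a + cmod b)\<close>, which gives the Lipschitz constant.\<close>
        define H where "H t = F (tr z D) t - F D t" for t
        have T: "tr z D \<in> admissible" using tr_admissible D z by blast
        have contH: "continuous_on UNIV H"
          unfolding H_def by (intro continuous_intros contF T D)
        have H: "cmod (H t) \<le> 2 * norm z" for t
        proof -
          let ?u = "const_bcontfun t * x"
          have "H t = (D (z + ?u) - D ?u) - D z" using x by (simp add: H_def F_def)
          then have "cmod (H t) \<le> cmod (D (z + ?u) - D ?u) + cmod (D z)"
            by (metis norm_triangle_ineq4)
          then show ?thesis
            using admissible_lipschitz[OF D, of "z + ?u" ?u] admissible_norm[OF D, of z] x z by simp
        qed
        have CI_H: "CI H p q = CI (F (tr z D)) p q - CI (F D) p q" for p q
          unfolding H_def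
          by (rule contour_integral_unique[OF has_contour_integral_diff[OF has_CI[OF contF[OF T]] has_CI[OF contF[OF D]]]])
        have CI_bound_H: "cmod (CI H p q) \<le> 2 * norm z * cmod (q - p)" for p q
          by (rule CI_bound[OF contH H])
        have "par_integral (F (tr z D)) a b - par_integral (F D) a b = CI H 0 a + CI H a (a + b) + CI H (a + b) b + CI H b 0"
          by (simp add: par_integral_def CI_H)
        then have "cmod (par_integral (F (tr z D)) a b - par_integral (F D) a b)
            \<le> cmod (CI H 0 a) + cmod (CI H a (a + b)) + cmod (CI H (a + b) b) + cmod (CI H b 0)"
          using norm_triangle_mono norm_triangle_ineq order_refl by metis
        also have "\<dots> \<le> 4 * (cmod a + cmod b) * norm z"
          using CI_bound_H[of 0 a] CI_bound_H[of a "a + b"] CI_bound_H[of "a + b" b] CI_bound_H[of b 0]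
          by (simp add: algebra_simps)
        finally have "cmod (c * (par_integral (F (tr z D)) a b - par_integral (F D) a b))
            \<le> cmod c * (4 * (cmod a + cmod b) * norm z)"
          unfolding norm_mult by (intro mult_left_mono) auto
        moreover have "?V (tr z D) - ?V D = Re (c * (par_integral (F (tr z D)) a b - par_integral (F D) a b))"
          by (simp add: algebra_simps)
        ultimately show ?thesis
          using abs_Re_le_cmod[of "c * (par_integral (F (tr z D)) a b - par_integral (F D) a b)"]
          by (simp only: mult.assoc)
      qed
      show "real 4 * ?V D = (\<Sum>k<4. ?V (tr (p k) (dbl D)))" if D: "D \<in> admissible" for D
      proof -
        have eq: "par_integral (F (tr (p k) (dbl D))) a b
            = par_integral (\<lambda>t. 2 * F D (([0, a, b, a + b] ! k + t) / 2)) a b" for k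
        proof -
          have "continuous_on UNIV (\<lambda>t. 2 * F D (([0, a, b, a + b] ! k + t) / 2))"
            by (intro continuous_intros continuous_on_compose2[OF contF[OF D]]) auto
          then show ?thesis
            unfolding p_def F_tr F_dbl by (rule par_integral_minus_const)
        qed
        have "(\<Sum>k<4. par_integral (F (tr (p k) (dbl D))) a b) = 4 * par_integral (F D) a b"
          unfolding eq using par_integral_subdivide[OF contF[OF D], of a b]
          by (simp add: eval_nat_numeral add.assoc)
        then have "Re (c * (\<Sum>k<4. par_integral (F (tr (p k) (dbl D))) a b)) = Re (c * (4 * par_integral (F D) a b))"
          by simp
        then show ?thesis
          by (simp add: sum_distrib_left Re_sum algebra_simps)
      qed
      show "0 < (4::nat)" by simp
    qed (rule that)
    obtain M where M: "invariant M" "M \<subseteq> C'" "\<And>N. invariant N \<Longrightarrow> N \<subseteq> M \<Longrightarrow> N = M"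
      using minimal_invariant[OF C'(1)] by metis
    obtain L where L: "L \<in> M" using invariant_nonempty[OF M(1)] by auto
    then have L_adm: "L \<in> admissible" using invariant_subset[OF M(1)] by auto
    have "L (const_bcontfun t * x) = t * L x" for t
      by (rule additive_admissible_homogeneous[OF L_adm _ x]) (rule minimal_additive[OF M(1,3) L])
    then have "F L = (\<lambda>t. t * L x)" by (simp add: F_def[abs_def])
    moreover have "CI (\<lambda>t. t * L x) p q = L x * q\<^sup>2 / 2 - L x * p\<^sup>2 / 2" for p q
    proof (rule contour_integral_unique)
      have "((\<lambda>t. t * L x) has_contour_integral
          (\<lambda>t. L x * t\<^sup>2 / 2) (pathfinish (linepath p q)) - (\<lambda>t. L x * t\<^sup>2 / 2) (pathstart (linepath p q))) (linepath p q)"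
        by (rule contour_integral_primitive[where S = UNIV]) (auto intro!: derivative_eq_intros)
      then show "((\<lambda>t. t * L x) has_contour_integral (L x * q\<^sup>2 / 2 - L x * p\<^sup>2 / 2)) (linepath p q)"
        by simp
    qed
    ultimately have "par_integral (F L) a b = 0"
      by (simp add: par_integral_def)
    then have "m = 0"
      using C'(3)[of L 0] L M(2) tr_0[OF L_adm] by auto
    then show ?thesis using C'(4)[OF D] by simp
  qed
  show ?thesis
    using le_0[of 1] le_0[of "-1"] le_0[of \<i>] le_0[of "-\<i>"] by (simp add: F_def[abs_def] complex_eq_iff)
qed

text \<open>Recentring provides the vanishing integrals at every base point, so \<open>D\<close> is
  affine along each complex line. Parallel lines stay at bounded distance, so the Lipschitz
  condition forces equal slopes.\<close>

theorem admissible_clinear: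
  assumes D: "D \<in> admissible" and x: "x \<in> A"
  shows "D (const_bcontfun c * x) = c * D x"
    and "y \<in> A \<Longrightarrow> D (y + x) = D y + D x"
proof -
  have ex: "\<exists>k. \<forall>t. D (y + const_bcontfun t * x) = D y + t * k" if y: "y \<in> A" for y
  proof -
    have T: "tr y D \<in> admissible" using tr_admissible D y by blast
    have "\<exists>k. \<forall>t. tr y D (const_bcontfun t * x) = tr y D (const_bcontfun 0 * x) + t * k"
    proof (rule Lipschitz_parallelograms_affine)
      show "cmod (tr y D (const_bcontfun s * x) - tr y D (const_bcontfun t * x)) \<le> norm x * cmod (s - t)" for s t
        by (rule admissible_line_lipschitz[OF T x])
      fix v a b
      let ?E = "tr (const_bcontfun v * x) (tr y D)"
      have E: "?E \<in> admissible" using tr_admissible T x by blast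
      have "par_integral (\<lambda>t. ?E (const_bcontfun t * x)) a b = 0"
        by (rule admissible_par_integral[OF E x])
      moreover have "(\<lambda>t. ?E (const_bcontfun t * x))
          = (\<lambda>t. tr y D (const_bcontfun (v + t) * x) - tr y D (const_bcontfun v * x))"
        using x by (simp add: fun_eq_iff const_bcontfun_add distrib_right del: tr_apply) (simp add: tr_def)
      moreover have "continuous_on UNIV (\<lambda>t. tr y D (const_bcontfun (v + t) * x))"
        by (intro continuous_on_compose2[OF continuous_on_line[OF T x]] continuous_intros) auto
      ultimately show "par_integral (\<lambda>t. tr y D (const_bcontfun (v + t) * x)) a b = 0"
        by (simp add: par_integral_minus_const)
    qed
    then show ?thesis using x by (simp add: algebra_simps)
  qed
  obtain k0 where k0: "\<And>t. D (const_bcontfun t * x) = t * k0"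
    using ex[OF zero_mem] admissible_0[OF D] by auto
  have k0_eq: "k0 = D x" using k0[of 1] by (simp add: const_bcontfun_1)
  show "D (const_bcontfun c * x) = c * D x" using k0 k0_eq by simp
  show "D (y + x) = D y + D x" if y: "y \<in> A"
  proof -
    obtain k where k: "\<And>t. D (y + const_bcontfun t * x) = D y + t * k" using ex[OF y] by auto
    have "cmod t * cmod (k - k0) \<le> 2 * norm y" for t
    proof -
      have "t * (k - k0) = (D (y + const_bcontfun t * x) - D (const_bcontfun t * x)) - D y"
        unfolding k k0 by (simp add: algebra_simps)
      then have "cmod t * cmod (k - k0) \<le> cmod (D (y + const_bcontfun t * x) - D (const_bcontfun t * x)) + cmod (D y)"
        by (metis norm_mult norm_triangle_ineq4)
      then show ?thesis
        using admissible_lipschitz[OF D, of "y + const_bcontfun t * x" "const_bcontfun t * x"]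
          admissible_norm[OF D, of y] x y by simp
    qed
    note le = this
    have "cmod (k - k0) \<le> 0"
    proof (rule ccontr)
      assume "\<not> ?thesis"
      then obtain n where "2 * norm y < real n * cmod (k - k0)"
        using reals_Archimedean3[of "cmod (k - k0)"] by (auto simp: not_le)
      then show False using le[of "of_nat n"] by simp
    qed
    then have "k = D x" using k0_eq by simp
    then show ?thesis using k[of 1] by (simp add: const_bcontfun_1)
  qed
qed

end

subsection \<open>Characters and isometries\<close>

context function_algebra
begin

definition character :: "(('k \<Rightarrow>\<^sub>C complex) \<Rightarrow> complex) \<Rightarrow> bool" where
  "character \<psi> \<longleftrightarrow> (\<forall>f\<in>A. \<forall>c. \<psi> (const_bcontfun c * f) = c * \<psi> f) \<and>
     (\<forall>f\<in>A. \<forall>g\<in>A. \<psi> (f + g) = \<psi> f + \<psi> g) \<and> (\<forall>f\<in>A. \<forall>g\<in>A. \<psi> (f * g) = \<psi> f * \<psi> g) \<and> \<psi> 1 = 1"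

lemma characterD:
  assumes "character \<psi>"
  shows character_const_mult: "f \<in> A \<Longrightarrow> \<psi> (const_bcontfun c * f) = c * \<psi> f"
    and character_add: "f \<in> A \<Longrightarrow> g \<in> A \<Longrightarrow> \<psi> (f + g) = \<psi> f + \<psi> g"
    and character_mult: "f \<in> A \<Longrightarrow> g \<in> A \<Longrightarrow> \<psi> (f * g) = \<psi> f * \<psi> g"
    and character_1: "\<psi> 1 = 1"
  using assms unfolding character_def by blast+

lemma character_diff: "character \<psi> \<Longrightarrow> f \<in> A \<Longrightarrow> g \<in> A \<Longrightarrow> \<psi> (f - g) = \<psi> f - \<psi> g"
  using character_add[of \<psi> "f - g" g] by simp

text \<open>Otherwise a multiple \<open>h\<close> of \<open>f\<close> has \<open>norm h < 1\<close>
  and \<open>\<psi> h = 1\<close>, and the geometric series \<open>s = 1 + h * s\<close> gives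
  \<open>\<psi> s = 1 + \<psi> s\<close>.\<close>

lemma character_bound:
  assumes \<psi>: "character \<psi>" and f: "f \<in> A"
  shows "cmod (\<psi> f) \<le> norm f"
proof (rule ccontr)
  assume "\<not> ?thesis"
  then have less: "norm f < cmod (\<psi> f)" by simp
  then have ne: "\<psi> f \<noteq> 0" using norm_ge_zero[of f] by auto
  define h where "h = const_bcontfun (1 / \<psi> f) * f"
  have h: "h \<in> A" "\<psi> h = 1"
    using f ne by (auto simp: h_def character_const_mult[OF \<psi>])
  have "norm h < 1"
    using less ne by (simp add: h_def norm_divide)
  then have summable: "summable (\<lambda>n. h ^ n)"
    by (rule complete_algebra_summable_geometric)
  define s where "s = (\<Sum>n. h ^ n)"
  have s: "s \<in> A"
    using sums_mem[OF summable_sums[OF summable]] h by (simp add: s_def)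
  have "s = 1 + h * s"
    using suminf_split_head[OF summable] suminf_mult[OF summable, of h] by (simp add: s_def)
  then have "\<psi> s = 1 + \<psi> h * \<psi> s"
    using character_add[OF \<psi>, of 1 "h * s"] character_mult[OF \<psi>, of h s] h s character_1[OF \<psi>] by simp
  then show False using h by simp
qed

end

section \<open>Vector fields tangent to the unit ball\<close>

text \<open>The radial part \<open>Re (cnj z * W)\<close> of the field \<open>W\<close> is
  \<open>(1 - (cmod z)\<^sup>2) * Re (cnj z * a)\<close>, which vanishes on the unit circle. So a
  step of length \<open>t\<close> leaves the disc only by an amount of second order.\<close>

lemma mobius_field_bound:
  fixes z a :: complex
  assumes "cmod z \<le> 1" "cmod a \<le> 1" "0 \<le> t" "t \<le> 1/2"
  shows "cmod (z + of_real t * (a - cnj a * (z * z))) \<le> 1 + 2 * t\<^sup>2"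
proof -
  define W where "W = a - cnj a * (z * z)"
  have W: "cmod W \<le> 2"
  proof -
    have "cmod W \<le> cmod a + cmod (cnj a * (z * z))" unfolding W_def by (rule norm_triangle_ineq4)
    also have "cmod (cnj a * (z * z)) \<le> 1 * (1 * 1)"
      unfolding norm_mult using assms by (intro mult_mono) auto
    finally show ?thesis using assms by simp
  qed
  have "Re (cnj z * W) = (1 - (cmod z)\<^sup>2) * Re (cnj z * a)"
    unfolding W_def cmod_power2 by (simp add: power2_eq_square algebra_simps)
  also have "\<dots> \<le> (1 - (cmod z)\<^sup>2) * 1"
  proof (rule mult_left_mono)
    have "Re (cnj z * a) \<le> cmod z * cmod a"
      using complex_Re_le_cmod[of "cnj z * a"] by (simp add: norm_mult)
    also have "\<dots> \<le> 1" using assms by (simp add: mult_le_one)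
    finally show "Re (cnj z * a) \<le> 1" .
    show "0 \<le> 1 - (cmod z)\<^sup>2" using assms by (simp add: power_le_one)
  qed
  finally have Re: "Re (cnj z * W) \<le> 1 - (cmod z)\<^sup>2" by simp
  have "(cmod (z + of_real t * W))\<^sup>2 = (cmod z)\<^sup>2 + (2 * t) * Re (cnj z * W) + t\<^sup>2 * (cmod W)\<^sup>2"
    unfolding cmod_power2 by (simp add: power2_eq_square algebra_simps)
  also have "\<dots> \<le> (cmod z)\<^sup>2 + 1 * (1 - (cmod z)\<^sup>2) + t\<^sup>2 * 2\<^sup>2"
  proof (intro add_mono mult_left_mono)
    have "(2 * t) * Re (cnj z * W) \<le> (2 * t) * (1 - (cmod z)\<^sup>2)"
      using Re assms by (intro mult_left_mono) auto
    also have "\<dots> \<le> 1 * (1 - (cmod z)\<^sup>2)"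
      using assms by (intro mult_right_mono) (auto simp: power_le_one)
    finally show "(2 * t) * Re (cnj z * W) \<le> 1 * (1 - (cmod z)\<^sup>2)" .
  qed (use power_mono[OF W, of 2] in auto)
  also have "\<dots> \<le> (1 + 2 * t\<^sup>2)\<^sup>2"
    using assms by (simp add: power2_eq_square algebra_simps)
  finally show ?thesis
    unfolding W_def by (rule power2_le_imp_le) simp
qed

text \<open>The pair \<open>w\<close>, \<open>w'\<close> will be \<open>1\<close>, \<open>1\<close>
  on \<open>A\<close>, and \<open>T 1\<close> with its conjugate on \<open>B\<close>.\<close>

lemma mobius_field_norm:
  fixes f w w' :: "'k::topological_space \<Rightarrow>\<^sub>C complex"
  assumes "norm f \<le> 1" "norm w \<le> 1" and w': "\<And>x. apply_bcontfun w' x = cnj (apply_bcontfun w x)"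
    and c: "cmod c = 1" and t: "0 \<le> t" "t \<le> 1/2"
  shows "norm (f + const_bcontfun (of_real t) * (const_bcontfun c * w - const_bcontfun (cnj c) * (w' * (f * f)))) \<le> 1 + 2 * t\<^sup>2"
proof (rule norm_bound)
  fix x
  have "cmod (apply_bcontfun f x) \<le> 1" "cmod (c * apply_bcontfun w x) \<le> 1"
    using norm_bounded[of f x] norm_bounded[of w x] assms by (auto simp: norm_mult)
  from mobius_field_bound[OF this t]
  show "norm (apply_bcontfun (f + const_bcontfun (of_real t) * (const_bcontfun c * w - const_bcontfun (cnj c) * (w' * (f * f)))) x) \<le> 1 + 2 * t\<^sup>2"
    by (simp add: w' mult.assoc)
qed

section \<open>Surjective linear isometries\<close>

locale function_isometry =
  A: function_algebra A + B: function_algebra B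
  for A :: "('k::topological_space \<Rightarrow>\<^sub>C complex) set" and B :: "('q::topological_space \<Rightarrow>\<^sub>C complex) set" +
  fixes T
  assumes iso: "T \<in> Iso A B"
begin

lemma T_add: "f \<in> A \<Longrightarrow> g \<in> A \<Longrightarrow> T (f + g) = T f + T g"
  and T_const_mult: "f \<in> A \<Longrightarrow> T (const_bcontfun c * f) = const_bcontfun c * T f"
  and T_image: "T ` A = B"
  and norm_T: "f \<in> A \<Longrightarrow> norm (T f) = norm f"
  using iso by (auto simp: Iso_def clinear_on_def scaleC_eq)

lemma T_mem [simp, intro]: "f \<in> A \<Longrightarrow> T f \<in> B"
  using T_image by auto

lemma T_diff: "f \<in> A \<Longrightarrow> g \<in> A \<Longrightarrow> T (f - g) = T f - T g"
  using T_add[of "f - g" g] by simp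

lemma T_0: "T 0 = 0"
  using T_diff[of 0 0] by simp

lemma inj_on_T: "inj_on T A"
  by (rule inj_onI) (metis A.diff_mem T_diff eq_iff_diff_eq_0 norm_T norm_eq_zero)

definition U where "U = inv_into A T"

lemma T_U: "g \<in> B \<Longrightarrow> T (U g) = g"
  and U_T: "f \<in> A \<Longrightarrow> U (T f) = f"
  using T_image inj_on_T by (auto simp: U_def f_inv_into_f)

lemma U_mem [simp, intro]: "g \<in> B \<Longrightarrow> U g \<in> A"
  using T_image by (auto simp: U_def inv_into_into)

lemma norm_U: "g \<in> B \<Longrightarrow> norm (U g) = norm g"
  using norm_T[of "U g"] by (simp add: T_U)

lemma U_add: "f \<in> B \<Longrightarrow> g \<in> B \<Longrightarrow> U (f + g) = U f + U g"
  by (metis A.add_mem T_U T_add U_T U_mem)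

lemma U_diff: "f \<in> B \<Longrightarrow> g \<in> B \<Longrightarrow> U (f - g) = U f - U g"
  by (metis A.diff_mem T_U T_diff U_T U_mem)

lemma U_const_mult: "f \<in> B \<Longrightarrow> U (const_bcontfun c * f) = const_bcontfun c * U f"
  by (metis A.const_mem A.mult_mem T_U T_const_mult U_T U_mem)

lemma U_0: "U 0 = 0"
  using U_diff[of 0 0] by simp

text \<open>This formula keeps \<open>w\<close> in \<open>B\<close>; it turns out to be the
  pointwise conjugate of \<open>T 1\<close>.\<close>

definition w where "w = T (U 1 * U 1)"

lemma w_mem [simp, intro]: "w \<in> B"
  by (auto simp: w_def)

lemma norm_T_1: "norm (T 1) \<le> 1"
  by (simp add: norm_T)

text \<open>At a point where \<open>cmod (T f)\<close> attains \<open>norm f\<close>, the vector field \<open>c - cnj c * f * f\<close>, being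
  tangent to the unit ball, is mapped by \<open>T\<close> to a tangent direction. For \<open>T f = 1\<close> this holds everywhere.\<close>

lemma w_apply: "apply_bcontfun w x = cnj (apply_bcontfun (T 1) x)"
proof -
  have Re_le: "Re (c * apply_bcontfun (T 1) x - cnj c * apply_bcontfun w x) \<le> 0" if c: "cmod c = 1" for c
  proof -
    let ?e = "U 1"
    define Z where "Z = c * apply_bcontfun (T 1) x - cnj c * apply_bcontfun w x"
    have le: "Re Z \<le> 4 * t" if t: "0 < t" "t \<le> 1/2" for t
    proof -
      have "norm (?e + const_bcontfun (of_real t) * (const_bcontfun c * 1 - const_bcontfun (cnj c) * (1 * (?e * ?e)))) \<le> 1 + 2 * t\<^sup>2"
        using t by (intro mobius_field_norm c) (auto simp: norm_U)
      then have "norm (T (?e + const_bcontfun (of_real t) * (const_bcontfun c * 1 - const_bcontfun (cnj c) * (1 * (?e * ?e))))) \<le> 1 + 2 * t\<^sup>2"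
        by (subst norm_T) auto
      moreover have "T (?e + const_bcontfun (of_real t) * (const_bcontfun c * 1 - const_bcontfun (cnj c) * (1 * (?e * ?e))))
          = 1 + const_bcontfun (of_real t) * (const_bcontfun c * T 1 - const_bcontfun (cnj c) * w)"
        by (subst T_add, simp, simp, subst T_const_mult, simp, subst T_diff, simp, simp,
            subst T_const_mult, simp, subst T_const_mult, simp) (simp add: T_U w_def)
      ultimately have "cmod (1 + of_real t * Z) \<le> 1 + 2 * t\<^sup>2"
        using norm_bounded[of "1 + const_bcontfun (of_real t) * (const_bcontfun c * T 1 - const_bcontfun (cnj c) * w)" x]
        by (simp add: Z_def)
      then have "t * Re Z \<le> 2 * t\<^sup>2"
        using complex_Re_le_cmod[of "1 + of_real t * Z"] by simp
      then show ?thesis using t by (simp add: power2_eq_square)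
    qed
    have "Re Z \<le> 0"
    proof (rule ccontr)
      assume pos: "\<not> ?thesis"
      \<comment> \<open>With \<open>t\<close> at most \<open>Re Z / 8\<close>, the bound
        \<open>4 * t\<close> is at most half of \<open>Re Z\<close>.\<close>
      then have "0 < min (1/2) (Re Z / 8)" by simp
      then have "Re Z \<le> 4 * min (1/2) (Re Z / 8)" by (intro le) auto
      then show False using pos by linarith
    qed
    then show ?thesis by (simp add: Z_def)
  qed
  show ?thesis
    using Re_le[of 1] Re_le[of "-1"] Re_le[of \<i>] Re_le[of "-\<i>"] by (simp add: complex_eq_iff)
qed

lemma norm_w: "norm w \<le> 1"
proof (rule norm_bound)
  show "norm (apply_bcontfun w x) \<le> 1" for x
    using norm_bounded[of "T 1" x] norm_T_1 by (simp add: w_apply)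
qed

text \<open>The quadratic parts of the fields on \<open>A\<close> and on \<open>B\<close>, compared
  inside \<open>A\<close>. That \<open>P\<close> vanishes is the multiplication rule for
  \<open>T\<close>.\<close>

definition P where "P f = f * f - U (w * (T f * T f))"

lemma P_mem [simp, intro]: "f \<in> A \<Longrightarrow> P f \<in> A"
  by (auto simp: P_def)

lemma P_const_mult: "f \<in> A \<Longrightarrow> P (const_bcontfun c * f) = const_bcontfun (c * c) * P f"
proof -
  assume f: "f \<in> A"
  have "w * (T (const_bcontfun c * f) * T (const_bcontfun c * f)) = const_bcontfun (c * c) * (w * (T f * T f))"
    unfolding T_const_mult[OF f] const_bcontfun_mult by (simp only: mult_ac)
  then have "U (w * (T (const_bcontfun c * f) * T (const_bcontfun c * f))) = const_bcontfun (c * c) * U (w * (T f * T f))"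
    using f by (simp add: U_const_mult)
  then show ?thesis
    by (simp add: P_def const_bcontfun_mult algebra_simps)
qed

text \<open>The flows of the fields \<open>c - cnj c * f * f\<close> on \<open>A\<close> and \<open>c * T 1 - cnj c * w * g * g\<close> on \<open>B\<close> both
  preserve the unit balls up to second order, hence so does their difference.\<close>

lemma P_bound_unit:
  assumes f: "f \<in> A" "norm f \<le> 1" and s: "cmod s \<le> 1/2"
  shows "norm (f + const_bcontfun s * P f) \<le> 1 + 10 * (cmod s)\<^sup>2"
proof (cases "s = 0")
  case False
  define t where "t = cmod s"
  \<comment> \<open>The phase for which the quadratic terms of the two steps below add up to
    \<open>s * P f\<close>.\<close>
  define c where "c = - cnj s / of_real t"
  have t: "0 < t" "t \<le> 1/2" using False s by (auto simp: t_def)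
  have c: "cmod c = 1" using False by (simp add: c_def t_def norm_divide)
  have s_eq: "s = - (of_real t * cnj c)" using t by (simp add: c_def)
  define r where "r = 1 + 2 * t\<^sup>2"
  have r: "1 \<le> r" by (simp add: r_def)
  let ?c = "const_bcontfun c :: 'k \<Rightarrow>\<^sub>C complex" and ?d = "const_bcontfun (cnj c) :: 'k \<Rightarrow>\<^sub>C complex"
  let ?t = "const_bcontfun (of_real t) :: 'k \<Rightarrow>\<^sub>C complex"
  \<comment> \<open>A step along the field on \<open>A\<close>; then \<open>f2\<close> rescales the
    result into the unit ball.\<close>
  define f1 where "f1 = f + ?t * (?c * 1 - ?d * (1 * (f * f)))"
  have "norm f1 \<le> r"
    unfolding f1_def r_def using f t by (intro mobius_field_norm c) auto
  moreover have "f1 \<in> A"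
    unfolding f1_def using f by auto
  ultimately have f1: "f1 \<in> A" "norm f1 \<le> r" by simp_all
  define f2 where "f2 = const_bcontfun (of_real (1 / r)) * f1"
  have f2: "f2 \<in> A" "norm f2 \<le> 1"
    using f1 r by (auto simp: f2_def norm_divide divide_le_eq)
  define h where "h = T f2"
  have h: "h \<in> B" "norm h \<le> 1" using f2 by (auto simp: h_def norm_T)
  \<comment> \<open>A step along the opposite field on \<open>B\<close>: pulled back to
    \<open>A\<close>, its constant term cancels that of the first step.\<close>
  let ?X = "h + const_bcontfun (of_real t) * (const_bcontfun (- c) * T 1 - const_bcontfun (cnj (- c)) * (w * (h * h)))"
  have "norm ?X \<le> r"
    unfolding r_def using h t c norm_T_1 by (intro mobius_field_norm) (auto simp: w_apply)
  moreover have "?X \<in> B" using h by auto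
  ultimately have "norm (U ?X) \<le> r" by (simp add: norm_U)
  moreover have "U ?X = f2 + ?t * (const_bcontfun (- c) - const_bcontfun (cnj (- c)) * U (w * (h * h)))"
  proof -
    have m: "w * (h * h) \<in> B" "const_bcontfun (cnj (- c)) * (w * (h * h)) \<in> B" "const_bcontfun (- c) * T 1 \<in> B"
      "const_bcontfun (- c) * T 1 - const_bcontfun (cnj (- c)) * (w * (h * h)) \<in> B" using h by auto
    then show ?thesis
      using h f2 by (simp add: U_add U_const_mult U_diff U_T h_def)
  qed
  ultimately have 1: "norm (f2 + ?t * (const_bcontfun (- c) - const_bcontfun (cnj (- c)) * U (w * (h * h)))) \<le> r" by simp
  have "f1 - f2 = const_bcontfun (of_real (1 - 1 / r)) * f1"
    by (simp add: f2_def const_bcontfun_diff const_bcontfun_1 algebra_simps)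
  then have "norm (f1 - f2) = \<bar>1 - 1 / r\<bar> * norm f1" by (simp only: norm_const_mult norm_of_real)
  then have "norm (f1 - f2) = (1 - 1 / r) * norm f1" using r by simp
  also have "\<dots> \<le> (1 - 1 / r) * r" using f1 r by (intro mult_left_mono) auto
  also have "\<dots> = 2 * t\<^sup>2" using r by (simp add: field_simps) (simp add: r_def algebra_simps)
  finally have 2: "norm (f1 - f2) \<le> 2 * t\<^sup>2" .
  have "norm (f1 - f) \<le> 2 * t"
  proof -
    have "norm (f1 - f) = t * norm (?c - ?d * (f * f))" using t by (simp add: f1_def)
    also have "norm (?c - ?d * (f * f)) \<le> norm ?c + norm (?d * (f * f))" by (rule norm_triangle_ineq4)
    also have "norm (?d * (f * f)) \<le> 1"
      using c norm_mult_ineq[of f f] mult_mono[OF f(2) f(2)] by simp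
    finally show ?thesis using t c by simp
  qed
  moreover have "2 * t\<^sup>2 \<le> t" using t by (simp add: power2_eq_square)
  ultimately have f_f2: "norm (f - f2) \<le> 3 * t"
    using 2 norm_triangle_ineq[of "f - f1" "f1 - f2"] by (simp add: norm_minus_commute)
  \<comment> \<open>The second field is evaluated at \<open>h\<close> instead of \<open>T f\<close>.
    The difference of the squares factors, and the prefactor \<open>t\<close> makes this error
    second order.\<close>
  let ?Y = "w * ((T f - h) * (T f + h))"
  have Y: "?Y \<in> B" using f h by auto
  have "norm ?Y \<le> norm w * (norm (T f - h) * norm (T f + h))"
    by (meson mult_left_mono norm_ge_zero norm_mult_ineq order_trans)
  also have "\<dots> \<le> 1 * (3 * t * 2)"
  proof (intro mult_mono norm_w)
    show "norm (T f - h) \<le> 3 * t" using f f2 f_f2 by (simp add: h_def T_diff[symmetric] norm_T)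
    show "norm (T f + h) \<le> 2" using norm_triangle_ineq[of "T f" h] f h by (simp add: norm_T)
  qed (use t in auto)
  finally have 3: "norm (?t * (?d * U ?Y)) \<le> 6 * t\<^sup>2"
    using t c Y by (simp add: norm_U power2_eq_square)
  have U_Y: "U (w * (T f * T f)) = U (w * (h * h)) + U ?Y"
    using f h Y by (subst U_add[symmetric]) (auto simp: algebra_simps)
  have "f + const_bcontfun s * P f
      = (f2 + ?t * (const_bcontfun (- c) - const_bcontfun (cnj (- c)) * U (w * (h * h)))) + (f1 - f2) + ?t * (?d * U ?Y)"
    unfolding P_def s_eq U_Y
    by (simp add: f1_def const_bcontfun_minus const_bcontfun_mult algebra_simps)
  also have "norm \<dots> \<le> r + 2 * t\<^sup>2 + 6 * t\<^sup>2"
    by (rule norm_triangle_mono[OF norm_triangle_mono[OF 1 2] 3])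
  finally show ?thesis by (simp add: r_def t_def)
qed (use f in simp)

text \<open>The unit ball estimate rescaled, using that \<open>P\<close> is homogeneous of degree
  two.\<close>

lemma P_bound:
  assumes f: "f \<in> A" "norm f \<le> r" and r: "0 < r" and s: "cmod s * r \<le> 1/2"
  shows "norm (f + const_bcontfun s * P f) \<le> r + 10 * (cmod s)\<^sup>2 * r ^ 3"
proof -
  define g where "g = const_bcontfun (of_real (1 / r)) * f"
  have g: "g \<in> A" "norm g \<le> 1" using f r by (auto simp: g_def norm_divide divide_le_eq)
  have f_eq: "f = const_bcontfun (of_real r) * g"
    using r by (simp add: g_def mult.assoc[symmetric] const_bcontfun_mult[symmetric] const_bcontfun_1)
  have "f + const_bcontfun s * P f = const_bcontfun (of_real r) * (g + const_bcontfun (s * of_real r) * P g)"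
    unfolding f_eq P_const_mult[OF g(1)] by (simp add: const_bcontfun_mult algebra_simps)
  then have "norm (f + const_bcontfun s * P f) = r * norm (g + const_bcontfun (s * of_real r) * P g)"
    using r by simp
  also have "\<dots> \<le> r * (1 + 10 * (cmod (s * of_real r))\<^sup>2)"
    using r s by (intro mult_left_mono P_bound_unit g) (auto simp: norm_mult)
  also have "\<dots> = r + 10 * (cmod s)\<^sup>2 * r ^ 3"
    using r by (simp add: norm_mult power_mult_distrib power2_eq_square power3_eq_cube algebra_simps)
  finally show ?thesis .
qed

end

text \<open>Polynomials over the algebra, evaluated at constants, record the dependence on
  \<open>s\<close>. Their coefficients must be tracked because \<open>T\<close> and its inverse are
  linear only on \<open>A\<close> and \<open>B\<close>.\<close>

definition coeffs_in :: "'x::zero set \<Rightarrow> 'x poly \<Rightarrow> bool" where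
  "coeffs_in S p \<longleftrightarrow> (\<forall>i. coeff p i \<in> S)"

lemma coeffs_in_pCons: "coeffs_in S (pCons a p) \<longleftrightarrow> a \<in> S \<and> coeffs_in S p"
  unfolding coeffs_in_def
  by (auto simp: coeff_pCons split: nat.splits)

context function_algebra
begin

lemma coeffs_in_mult: "coeffs_in A p \<Longrightarrow> coeffs_in A q \<Longrightarrow> coeffs_in A (p * q)"
  by (auto simp: coeffs_in_def coeff_mult intro!: sum_mem)

lemma poly_const_mem: "coeffs_in A p \<Longrightarrow> poly p (const_bcontfun s) \<in> A"
  by (induction p) (auto simp: coeffs_in_pCons)

end

section \<open>Iteration and Cartan's uniqueness principle\<close>

context function_isometry
begin

definition iter :: "complex \<Rightarrow> ('k \<Rightarrow>\<^sub>C complex) \<Rightarrow> nat \<Rightarrow> 'k \<Rightarrow>\<^sub>C complex" where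
  "iter s f k = ((\<lambda>g. g + const_bcontfun s * P g) ^^ k) f"

lemma iter_0 [simp]: "iter s f 0 = f"
  and iter_Suc: "iter s f (Suc k) = iter s f k + const_bcontfun s * P (iter s f k)"
  by (simp_all add: iter_def)

lemma iter_mem: "f \<in> A \<Longrightarrow> iter s f k \<in> A"
  by (induction k) (auto simp: iter_Suc)

text \<open>As long as the norm stays at most 2, a step adds at most
  \<open>10 * (cmod s)\<^sup>2 * 2 ^ 3\<close>, and the choice of \<open>s\<close> makes this
  \<open>1 / n\<close>.\<close>

lemma norm_iter_le:
  assumes f: "f \<in> A" "norm f \<le> 1" and n: "0 < n" and s: "80 * real n * (cmod s)\<^sup>2 = 1"
  shows "k \<le> n \<Longrightarrow> norm (iter s f k) \<le> 1 + real k / real n"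
proof (induction k)
  case (Suc k)
  define r where "r = 1 + real k / real n"
  have r: "1 \<le> r" "r \<le> 2" using Suc.prems n by (auto simp: r_def)
  have "80 * (cmod s)\<^sup>2 \<le> 80 * real n * (cmod s)\<^sup>2"
    using n by (simp add: mult_le_cancel_right1)
  then have "(cmod s)\<^sup>2 \<le> (1/4)\<^sup>2" using s by (simp add: power2_eq_square)
  then have "cmod s \<le> 1/4" by (rule power2_le_imp_le) simp
  have IH: "norm (iter s f k) \<le> r" using Suc by (simp add: r_def)
  from \<open>cmod s \<le> 1/4\<close> have "cmod s * r \<le> 1/4 * 2" using r by (intro mult_mono) auto
  then have "norm (iter s f (Suc k)) \<le> r + 10 * (cmod s)\<^sup>2 * r ^ 3"
    unfolding iter_Suc using IH r by (intro P_bound iter_mem f) auto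
  also have "\<dots> \<le> r + 10 * (cmod s)\<^sup>2 * 2 ^ 3"
    using r by (intro add_left_mono mult_left_mono power_mono) auto
  also have "80 * (cmod s)\<^sup>2 = 1 / real n" using s n by (simp add: field_simps)
  then have "10 * (cmod s)\<^sup>2 * 2 ^ 3 = 1 / real n" by simp
  finally show ?case by (simp add: r_def add_divide_distrib)
qed (use f in simp)

lemma poly_map_T:
  "coeffs_in A p \<Longrightarrow> poly (map_poly T p) (const_bcontfun s) = T (poly p (const_bcontfun s))"
proof (induction p)
  case (pCons a p)
  then show ?case
    using A.poly_const_mem[of p s]
    by (simp add: coeffs_in_pCons map_poly_pCons T_0 T_add T_const_mult)
qed (simp add: T_0)

lemma poly_map_U:
  "coeffs_in B p \<Longrightarrow> poly (map_poly U p) (const_bcontfun s) = U (poly p (const_bcontfun s))"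
proof (induction p)
  case (pCons a p)
  then show ?case
    using B.poly_const_mem[of p s]
    by (simp add: coeffs_in_pCons map_poly_pCons U_0 U_add U_const_mult)
qed (simp add: U_0)

definition P_poly where
  "P_poly p = p * p - map_poly U (smult w (map_poly T p * map_poly T p))"

lemma coeffs_in_map_T: "coeffs_in A p \<Longrightarrow> coeffs_in B (map_poly T p)"
  by (simp add: coeffs_in_def coeff_map_poly T_0)

lemma coeffs_in_P_poly_aux: "coeffs_in A p \<Longrightarrow> coeffs_in B (smult w (map_poly T p * map_poly T p))"
  using B.coeffs_in_mult[OF coeffs_in_map_T coeffs_in_map_T] by (auto simp: coeffs_in_def)

lemma coeffs_in_P_poly: "coeffs_in A p \<Longrightarrow> coeffs_in A (P_poly p)"
  using A.coeffs_in_mult[of p p] coeffs_in_P_poly_aux[of p]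
  by (auto simp: coeffs_in_def P_poly_def coeff_map_poly U_0)

lemma poly_P_poly:
  "coeffs_in A p \<Longrightarrow> poly (P_poly p) (const_bcontfun s) = P (poly p (const_bcontfun s))"
  by (simp add: P_poly_def P_def poly_map_U[OF coeffs_in_P_poly_aux] poly_map_T)

lemma coeff_0_P_poly: "coeff (P_poly p) 0 = P (coeff p 0)"
  by (simp add: P_poly_def P_def coeff_map_poly U_0 T_0 coeff_mult_0)

text \<open>By \<open>norm_iter_le\<close> the polynomial \<open>s \<mapsto> iter s f n\<close> is bounded by \<open>2\<close> on a circle of radius of order
  \<open>1 / sqrt n\<close>, while its linear coefficient is \<open>n * P f\<close>.\<close>

lemma iter_poly:
  assumes f: "f \<in> A"
  obtains p where "coeffs_in A p" "\<And>s. poly p (const_bcontfun s) = iter s f k"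
    "coeff p 0 = f" "coeff p (Suc 0) = of_nat k * P f"
proof (induction k arbitrary: thesis)
  case 0
  show ?case by (rule 0[of "[:f:]"]) (use f in \<open>auto simp: coeffs_in_def coeff_pCons split: nat.split\<close>)
next
  case (Suc k)
  obtain p where p: "coeffs_in A p" "\<And>s. poly p (const_bcontfun s) = iter s f k"
    "coeff p 0 = f" "coeff p (Suc 0) = of_nat k * P f"
    using Suc.IH by blast
  show ?case
  proof (rule Suc.prems[of "p + pCons 0 (P_poly p)"])
    have "coeffs_in A (pCons 0 (P_poly p))"
      using coeffs_in_P_poly[OF p(1)] by (simp add: coeffs_in_pCons)
    then show "coeffs_in A (p + pCons 0 (P_poly p))"
      using p(1) by (auto simp: coeffs_in_def)
    show "poly (p + pCons 0 (P_poly p)) (const_bcontfun s) = iter s f (Suc k)" for s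
      by (simp add: poly_P_poly[OF p(1)] p(2) iter_Suc)
  qed (simp_all add: p coeff_0_P_poly algebra_simps)
qed

text \<open>Cauchy's estimate bounds the linear coefficient \<open>n * P f\<close> at each point by
  \<open>2 * sqrt (80 * n)\<close>; squaring gives \<open>320 = 4 * 80\<close>, and \<open>n\<close>
  is arbitrary.\<close>

lemma P_eq_0_unit:
  assumes f: "f \<in> A" "norm f \<le> 1"
  shows "P f = 0"
proof (rule bcontfun_eqI)
  fix x
  have le: "real n * (cmod (apply_bcontfun (P f) x))\<^sup>2 \<le> 320" if n: "0 < n" for n
  proof -
    obtain p where p: "\<And>s. poly p (const_bcontfun s) = iter s f n" "coeff p (Suc 0) = of_nat n * P f"
      using iter_poly[OF f(1), of n] by metis
    define q where "q = map_poly (\<lambda>b. apply_bcontfun b x) p"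
    have q_poly: "poly (map_poly (\<lambda>b. apply_bcontfun b x) p) s = apply_bcontfun (poly p (const_bcontfun s)) x"
      for s and p :: "('k \<Rightarrow>\<^sub>C complex) poly"
      by (induction p) (auto simp: map_poly_pCons)
    define \<rho> where "\<rho> = 1 / sqrt (80 * real n)"
    have \<rho>: "0 < \<rho>" "80 * real n * \<rho>\<^sup>2 = 1"
      using n by (simp_all add: \<rho>_def power_divide)
    have "cmod ((deriv ^^ 1) (poly q) 0) \<le> fact 1 * 2 / \<rho> ^ 1"
    proof (rule Cauchy_inequality)
      show "poly q holomorphic_on ball 0 \<rho>" by (intro holomorphic_intros)
      show "continuous_on (cball 0 \<rho>) (poly q)" by (intro continuous_intros)
      fix s :: complex assume "norm (0 - s) = \<rho>"
      then have s: "cmod s = \<rho>" by simp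
      have "poly q s = apply_bcontfun (iter s f n) x"
        by (simp add: q_def q_poly p(1))
      also have "cmod \<dots> \<le> norm (iter s f n)" by (rule norm_bounded)
      also have "\<dots> \<le> 1 + real n / real n"
        using \<rho> s by (intro norm_iter_le f n) auto
      finally show "cmod (poly q s) \<le> 2" using n by simp
    qed (use \<rho> in auto)
    moreover have "deriv (poly q) 0 = coeff q (Suc 0)"
      using DERIV_imp_deriv[OF poly_DERIV[of q 0]] by (simp add: poly_0_coeff_0 coeff_pderiv)
    moreover have "apply_bcontfun (of_nat m :: 'k \<Rightarrow>\<^sub>C complex) x = of_nat m" for m
      by (induction m) auto
    then have "coeff q (Suc 0) = of_nat n * apply_bcontfun (P f) x"
      by (simp add: q_def coeff_map_poly p)
    ultimately have "real n * cmod (apply_bcontfun (P f) x) \<le> 2 / \<rho>"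
      by (simp add: norm_mult)
    then have "real n * cmod (apply_bcontfun (P f) x) * \<rho> \<le> 2"
      using \<rho> by (simp add: field_simps)
    then have "(real n * cmod (apply_bcontfun (P f) x) * \<rho>)\<^sup>2 \<le> 2\<^sup>2"
      using \<rho> by (intro power_mono) auto
    moreover have "80 * (real n * cmod (apply_bcontfun (P f) x) * \<rho>)\<^sup>2
        = (80 * real n * \<rho>\<^sup>2) * (real n * (cmod (apply_bcontfun (P f) x))\<^sup>2)"
      by (simp add: power2_eq_square algebra_simps)
    ultimately show ?thesis unfolding \<rho>(2) by simp
  qed
  have "(cmod (apply_bcontfun (P f) x))\<^sup>2 \<le> 0"
  proof (rule ccontr)
    assume "\<not> ?thesis"
    then obtain n where n: "320 < real n * (cmod (apply_bcontfun (P f) x))\<^sup>2"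
      using reals_Archimedean3[of "(cmod (apply_bcontfun (P f) x))\<^sup>2"] by (auto simp: not_le)
    then have "0 < n" by (cases n) auto
    then show False using le[of n] n by simp
  qed
  then show "apply_bcontfun (P f) x = apply_bcontfun 0 x" by simp
qed

lemma T_square: "f \<in> A \<Longrightarrow> T (f * f) = w * (T f * T f)"
proof -
  assume f: "f \<in> A"
  define r where "r = norm f + 1"
  have r: "0 < r" by (simp add: r_def add_nonneg_pos)
  define g where "g = const_bcontfun (of_real (1 / r)) * f"
  have g: "g \<in> A" "norm g \<le> 1"
    using f r by (auto simp: g_def norm_divide divide_le_eq r_def)
  have "f = const_bcontfun (of_real r) * g"
    using r by (simp add: g_def mult.assoc[symmetric] const_bcontfun_mult[symmetric] const_bcontfun_1)
  then have "P f = 0"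
    using P_const_mult[OF g(1)] P_eq_0_unit[OF g] by simp
  then have "f * f = U (w * (T f * T f))" by (simp add: P_def)
  then show ?thesis using f by (simp add: T_U)
qed

text \<open>Polarisation of \<open>T_square\<close>.\<close>

lemma T_mult:
  assumes "f \<in> A" "g \<in> A"
  shows "T (f * g) = w * (T f * T g)"
proof -
  have "(T (f * f) + T (f * g)) + (T (f * g) + T (g * g)) = T ((f * f + f * g) + (f * g + g * g))"
    using assms by (simp only: T_add A.add_mem A.mult_mem)
  also have "(f * f + f * g) + (f * g + g * g) = (f + g) * (f + g)"
    by (simp add: algebra_simps)
  also have "T ((f + g) * (f + g)) = w * (T (f + g) * T (f + g))"
    using assms by (intro T_square) auto
  also have "T (f + g) = T f + T g"
    using assms by (rule T_add)
  finally have "2 * T (f * g) = 2 * (w * (T f * T g))"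
    using assms by (simp add: T_square algebra_simps)
  then have "apply_bcontfun (2 * T (f * g)) x = apply_bcontfun (2 * (w * (T f * T g))) x" for x by simp
  moreover have "apply_bcontfun (2 :: 'q \<Rightarrow>\<^sub>C complex) x = 2" for x
    by (metis one_add_one one_bcontfun_apply plus_bcontfun.rep_eq)
  ultimately show ?thesis
    by (intro bcontfun_eqI) simp
qed

text \<open>As \<open>w\<close> is the conjugate of \<open>T 1\<close>, the product rule at
  \<open>1\<close> reads \<open>T 1 = \<bar>T 1\<bar>\<^sup>2 * T 1\<close> pointwise; at
  \<open>U 1\<close> it gives \<open>w * T 1 = 1\<close>, which excludes zeros.\<close>

lemma cmod_T_1: "cmod (apply_bcontfun (T 1) x) = 1"
proof -
  have "T 1 = w * (T 1 * T 1)" using T_mult[of 1 1] by simp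
  then have "apply_bcontfun (T 1) x = apply_bcontfun (w * (T 1 * T 1)) x" by simp
  then have "apply_bcontfun (T 1) x = of_real ((cmod (apply_bcontfun (T 1) x))\<^sup>2) * apply_bcontfun (T 1) x"
    by (subst complex_norm_square) (simp add: w_apply mult_ac)
  moreover have "apply_bcontfun (T 1) x \<noteq> 0"
  proof
    assume "apply_bcontfun (T 1) x = 0"
    then have "apply_bcontfun (w * T 1) x = 0" by simp
    moreover have "w * T 1 = 1"
      using T_mult[of 1 "U 1"] by (simp add: T_U)
    ultimately show False by simp
  qed
  ultimately have "(cmod (apply_bcontfun (T 1) x))\<^sup>2 = 1\<^sup>2"
    by (metis mult_cancel_right1 of_real_eq_1_iff one_power2)
  then show ?thesis
    by (metis norm_ge_zero power2_eq_imp_eq zero_le_one)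
qed

text \<open>This supplies the lower bound at multiples of exponentials demanded by
  \<open>admissible\<close>.\<close>

lemma T_unit_lower_bound:
  assumes "f \<in> A" "g \<in> A" "f * g = 1"
  shows "1 \<le> cmod (apply_bcontfun (T f) x) * norm g"
proof -
  have "apply_bcontfun (T 1) x = apply_bcontfun (w * (T f * T g)) x"
    using T_mult[of f g] assms by simp
  then have "cmod (apply_bcontfun (T 1) x) = cmod (apply_bcontfun (w * (T f * T g)) x)"
    by (rule arg_cong)
  then have "1 = cmod (apply_bcontfun (T f) x) * cmod (apply_bcontfun (T g) x)"
    by (simp add: w_apply norm_mult cmod_T_1)
  also have "\<dots> \<le> cmod (apply_bcontfun (T f) x) * norm g"
    using norm_bounded[of "T g" x] norm_T[OF assms(2)] by (intro mult_left_mono) auto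
  finally show ?thesis .
qed

end

subsection \<open>Weak 2-local maps\<close>

text \<open>An isometry fixing \<open>0\<close> preserves inner products. Pairing the displacement
  at \<open>s\<close> with a far point in its own direction would exceed any bound unless it is
  zero.\<close>

lemma isometry_of_plane_near_identity:
  fixes \<phi> :: "complex \<Rightarrow> complex"
  assumes iso: "\<And>s t. cmod (\<phi> s - \<phi> t) = cmod (s - t)" and zero: "\<phi> 0 = 0"
    and near: "\<And>s. cmod (\<phi> s - s) \<le> K"
  shows "\<phi> s = s"
proof -
  have inner_eq: "\<phi> s \<bullet> \<phi> t = s \<bullet> t" for s t
    using iso[of s t] iso[of s 0] iso[of t 0] zero by (simp add: dot_norm_neg)
  have le: "real n * (cmod (\<phi> s - s))\<^sup>2 \<le> cmod s * K" for n
  proof -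
    define u where "u = of_nat n * (\<phi> s - s)"
    have "(\<phi> s - s) \<bullet> u = \<phi> s \<bullet> u - \<phi> s \<bullet> \<phi> u"
      by (simp add: inner_eq inner_diff_left)
    also have "\<dots> = - (\<phi> s \<bullet> (\<phi> u - u))" by (simp add: inner_diff_right)
    also have "\<dots> \<le> cmod (\<phi> s) * cmod (\<phi> u - u)"
      using Cauchy_Schwarz_ineq2[of "\<phi> s" "\<phi> u - u"] by linarith
    also have "\<dots> \<le> cmod s * K"
      using iso[of s 0] zero near[of u] by (intro mult_mono) auto
    finally have "(\<phi> s - s) \<bullet> u \<le> cmod s * K" .
    moreover have "u = real n *\<^sub>R (\<phi> s - s)" by (simp add: u_def scaleR_conv_of_real)
    ultimately show ?thesis by (simp add: power2_norm_eq_inner)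
  qed
  have "(cmod (\<phi> s - s))\<^sup>2 \<le> 0"
  proof (rule ccontr)
    assume "\<not> ?thesis"
    then obtain n where "cmod s * K < real n * (cmod (\<phi> s - s))\<^sup>2"
      using reals_Archimedean3[of "(cmod (\<phi> s - s))\<^sup>2"] by (auto simp: not_le)
    then show False using le[of n] by simp
  qed
  then show ?thesis by simp
qed

context function_algebra
begin

lemma exp_units:
  assumes "y \<in> A" "c \<noteq> 0"
  shows "const_bcontfun c * exp y * (const_bcontfun (1 / c) * exp (- y)) = 1"
proof -
  have "const_bcontfun c * exp y * (const_bcontfun (1 / c) * exp (- y))
      = const_bcontfun (c * (1 / c)) * (exp y * exp (- y))"
    by (simp only: const_bcontfun_mult mult_ac)
  then show ?thesis
    using assms by (simp add: exp_mult_exp_minus const_bcontfun_1)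
qed

text \<open>The factor \<open>u\<close> normalises the value at \<open>1\<close>, which an isometry
  only fixes up to a unimodular number.\<close>

lemma clinear_on_if_admissible:
  fixes \<Delta> :: "('k \<Rightarrow>\<^sub>C complex) \<Rightarrow> ('q::topological_space \<Rightarrow>\<^sub>C complex)"
  assumes "\<And>x. \<exists>u D. u \<noteq> 0 \<and> D \<in> admissible \<and> (\<forall>f\<in>A. D f = u * apply_bcontfun (\<Delta> f) x)"
  shows "clinear_on A scaleC_bcontfun \<Delta>"
  unfolding clinear_on_def scaleC_eq
proof (intro conjI ballI allI)
  fix f g c assume f: "f \<in> A"
  show "\<Delta> (f + g) = \<Delta> f + \<Delta> g" if g: "g \<in> A"
  proof (rule bcontfun_eqI)
    fix x
    obtain u D where D: "u \<noteq> 0" "D \<in> admissible" "\<forall>f\<in>A. D f = u * apply_bcontfun (\<Delta> f) x"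
      using assms by blast
    then have "u * apply_bcontfun (\<Delta> (f + g)) x = u * apply_bcontfun (\<Delta> f + \<Delta> g) x"
      using admissible_clinear(2)[OF D(2) g f] f g by (simp add: distrib_left)
    then show "apply_bcontfun (\<Delta> (f + g)) x = apply_bcontfun (\<Delta> f + \<Delta> g) x"
      using D(1) by simp
  qed
  show "\<Delta> (const_bcontfun c * f) = const_bcontfun c * \<Delta> f"
  proof (rule bcontfun_eqI)
    fix x
    obtain u D where D: "u \<noteq> 0" "D \<in> admissible" "\<forall>f\<in>A. D f = u * apply_bcontfun (\<Delta> f) x"
      using assms by blast
    then have "u * apply_bcontfun (\<Delta> (const_bcontfun c * f)) x = u * apply_bcontfun (const_bcontfun c * \<Delta> f) x"
      using admissible_clinear(1)[OF D(2) f, of c] f by simp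
    then show "apply_bcontfun (\<Delta> (const_bcontfun c * f)) x = apply_bcontfun (const_bcontfun c * \<Delta> f) x"
      using D(1) by simp
  qed
qed

end

lemma evaluation_in_dual: "(\<lambda>g. apply_bcontfun g x) \<in> dual B"
proof -
  have "continuous_on B (\<lambda>g. apply_bcontfun g x)"
    by (rule lipschitz_on_continuous_on[of 1])
       (auto simp: lipschitz_on_def dist_bounded)
  then show ?thesis by (simp add: dual_def clinear_on_def)
qed

lemma weak_2_local_evaluation:
  assumes "weak_2_local \<T> A B \<Delta>" "f \<in> A" "g \<in> A"
  obtains T where "T \<in> \<T>" "apply_bcontfun (\<Delta> f) x = apply_bcontfun (T f) x"
    "apply_bcontfun (\<Delta> g) x = apply_bcontfun (T g) x"
proof -
  have "\<forall>\<phi>\<in>dual B. \<exists>T\<in>\<T>. \<phi> (\<Delta> f) = \<phi> (T f) \<and> \<phi> (\<Delta> g) = \<phi> (T g)"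
    using assms by (simp add: weak_2_local_def)
  from bspec[OF this evaluation_in_dual[of x]] show thesis
    using that by auto
qed

section \<open>Evaluations of weak 2-local maps are admissible\<close>

locale function_algebra_pair =
  A: function_algebra A + B: function_algebra B
  for A :: "('k::topological_space \<Rightarrow>\<^sub>C complex) set" and B :: "('q::topological_space \<Rightarrow>\<^sub>C complex) set"
begin

text \<open>Every admissibility condition involves at most two elements of \<open>A\<close>, and on
  these \<open>\<Delta>\<close> followed by evaluation agrees with a single character.\<close>

lemma weak_2_local_isomorphism_clinear:
  assumes \<Delta>: "weak_2_local_isomorphism A B \<Delta>"
  shows "clinear_on A scaleC_bcontfun \<Delta>"
proof (rule A.clinear_on_if_admissible)
  fix x
  have ex: "\<exists>\<psi>. A.character \<psi> \<and> apply_bcontfun (\<Delta> f) x = \<psi> f \<and> apply_bcontfun (\<Delta> g) x = \<psi> g"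
    if fg: "f \<in> A" "g \<in> A" for f g
  proof -
    obtain T where T: "T \<in> AlgIso A B" "apply_bcontfun (\<Delta> f) x = apply_bcontfun (T f) x"
      "apply_bcontfun (\<Delta> g) x = apply_bcontfun (T g) x"
      using weak_2_local_evaluation[OF \<Delta>[unfolded weak_2_local_isomorphism_def] fg] by metis
    \<comment> \<open>By surjectivity \<open>1\<close> is some \<open>T e\<close>, and
      multiplicativity then forces \<open>T 1 = 1\<close>.\<close>
    have "1 \<in> T ` A" using T(1) B.one_mem by (auto simp: AlgIso_def bij_betw_def)
    then obtain e where e: "e \<in> A" "T e = 1" by auto
    have "T (1 * e) = T 1 * T e" using T(1) e(1) A.one_mem by (simp add: AlgIso_def del: mult_1 mult_1_left)
    then have "T 1 = 1" using e by simp
    then have "A.character (\<lambda>f. apply_bcontfun (T f) x)"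
      unfolding A.character_def
    proof (intro conjI ballI allI)
      fix f g c assume f: "f \<in> A"
      have "T (const_bcontfun c * f) = const_bcontfun c * T f"
        using T(1) f by (simp only: AlgIso_def clinear_on_def scaleC_eq mem_Collect_eq)
      then show "apply_bcontfun (T (const_bcontfun c * f)) x = c * apply_bcontfun (T f) x" by simp
      assume g: "g \<in> A"
      show "apply_bcontfun (T (f + g)) x = apply_bcontfun (T f) x + apply_bcontfun (T g) x"
        "apply_bcontfun (T (f * g)) x = apply_bcontfun (T f) x * apply_bcontfun (T g) x"
        using T(1) f g by (simp_all add: AlgIso_def clinear_on_def)
    qed simp
    from conjI[OF this conjI[OF T(2,3)]] show ?thesis
      by (rule exI[of _ "\<lambda>f. apply_bcontfun (T f) x"])
  qed
  define D where "D f = (if f \<in> A then apply_bcontfun (\<Delta> f) x else 0)" for f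
  have "D \<in> A.admissible"
    unfolding A.admissible_def
  proof (intro CollectI conjI ballI allI impI)
    fix f g y :: "'k \<Rightarrow>\<^sub>C complex" and s c :: complex
    show "f \<notin> A \<Longrightarrow> D f = 0" by (simp add: D_def)
    show "D 0 = 0"
    proof -
      obtain \<psi> where "A.character \<psi>" "apply_bcontfun (\<Delta> 0) x = \<psi> 0"
        using ex[of 0 0] A.zero_mem by blast
      then show ?thesis using A.character_diff[of \<psi> 0 0] by (simp add: D_def)
    qed
    assume f: "f \<in> A"
    show "cmod (D f - D g) \<le> norm (f - g)" if g: "g \<in> A"
    proof -
      obtain \<psi> where \<psi>: "A.character \<psi>" "apply_bcontfun (\<Delta> f) x = \<psi> f" "apply_bcontfun (\<Delta> g) x = \<psi> g"
        using ex[OF f g] by blast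
      then show ?thesis
        using A.character_bound[OF \<psi>(1), of "f - g"] A.character_diff[OF \<psi>(1) f g] f g by (simp add: D_def)
    qed
    show "D (f + const_bcontfun s) = D f + s"
    proof -
      obtain \<psi> where \<psi>: "A.character \<psi>" "apply_bcontfun (\<Delta> f) x = \<psi> f"
        "apply_bcontfun (\<Delta> (f + const_bcontfun s)) x = \<psi> (f + const_bcontfun s)"
        using ex[of f "f + const_bcontfun s"] f by blast
      have "\<psi> (f + const_bcontfun s) = \<psi> f + s"
        using A.character_const_mult[OF \<psi>(1) A.one_mem, of s] A.character_1[OF \<psi>(1)]
          A.character_add[OF \<psi>(1) f A.const_mem, of s] by simp
      then show ?thesis using \<psi> f by (simp add: D_def)
    qed
    show "cmod c \<le> cmod (D (f + const_bcontfun c * exp y) - D f) * norm (exp (- y))" if y: "y \<in> A"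
    proof -
      let ?g = "f + const_bcontfun c * exp y"
      have g: "?g \<in> A" using f y by blast
      obtain \<psi> where \<psi>: "A.character \<psi>" "apply_bcontfun (\<Delta> ?g) x = \<psi> ?g" "apply_bcontfun (\<Delta> f) x = \<psi> f"
        using ex[OF g f] by blast
      have e: "exp y \<in> A" "exp (- y) \<in> A" using y by auto
      have "\<psi> (exp y) * \<psi> (exp (- y)) = \<psi> (exp y * exp (- y))" using A.character_mult[OF \<psi>(1) e] by simp
      also have "\<dots> = 1" using A.character_1[OF \<psi>(1)] by (simp add: exp_mult_exp_minus)
      finally have unit: "cmod (\<psi> (exp y)) * cmod (\<psi> (exp (- y))) = 1"
        by (metis norm_mult norm_one)
      have "D ?g - D f = c * \<psi> (exp y)"
        using A.character_diff[OF \<psi>(1) g f] A.character_const_mult[OF \<psi>(1) e(1), of c] \<psi>(2,3) f g by (simp add: D_def)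
      then have "cmod c = cmod (D ?g - D f) * cmod (\<psi> (exp (- y)))"
        using unit by (simp add: norm_mult mult.assoc)
      also have "\<dots> \<le> cmod (D ?g - D f) * norm (exp (- y))"
        using A.character_bound[OF \<psi>(1) e(2)] by (intro mult_left_mono) auto
      finally show ?thesis .
    qed
  qed
  then show "\<exists>u D. u \<noteq> 0 \<and> D \<in> A.admissible \<and> (\<forall>f\<in>A. D f = u * apply_bcontfun (\<Delta> f) x)"
    by (intro exI[of _ 1] exI[of _ D]) (auto simp: D_def)
qed

lemma weak_2_local_isometry_clinear:
  assumes \<Delta>: "weak_2_local_isometry A B \<Delta>"
  shows "clinear_on A scaleC_bcontfun \<Delta>"
proof (rule A.clinear_on_if_admissible)
  fix x
  have ex: "\<exists>T. function_isometry A B T \<and> apply_bcontfun (\<Delta> f) x = apply_bcontfun (T f) x \<and>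
      apply_bcontfun (\<Delta> g) x = apply_bcontfun (T g) x" if fg: "f \<in> A" "g \<in> A" for f g
  proof -
    obtain T where "T \<in> Iso A B" "apply_bcontfun (\<Delta> f) x = apply_bcontfun (T f) x"
      "apply_bcontfun (\<Delta> g) x = apply_bcontfun (T g) x"
      using weak_2_local_evaluation[OF \<Delta>[unfolded weak_2_local_isometry_def] fg] by metis
    then show ?thesis
      using function_isometry.intro[OF A.function_algebra_axioms B.function_algebra_axioms]
        function_isometry_axioms.intro by blast
  qed
  \<comment> \<open>Normalises \<open>D\<close> so that \<open>D 1 = 1\<close>.\<close>
  define u where "u = cnj (apply_bcontfun (\<Delta> 1) x)"
  obtain T1 where "function_isometry A B T1" "apply_bcontfun (\<Delta> 1) x = apply_bcontfun (T1 1) x"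
    using ex[OF A.one_mem A.one_mem] by blast
  then have u: "cmod u = 1"
    by (simp add: u_def function_isometry.cmod_T_1)
  define D where "D f = (if f \<in> A then u * apply_bcontfun (\<Delta> f) x else 0)" for f
  have pair: "cmod (D f - D g) \<le> norm (f - g)"
    "h \<in> A \<Longrightarrow> (f - g) * h = 1 \<Longrightarrow> 1 \<le> cmod (D f - D g) * norm h" if f: "f \<in> A" and g: "g \<in> A" for f g h
  proof -
    obtain T where T: "function_isometry A B T" "apply_bcontfun (\<Delta> f) x = apply_bcontfun (T f) x"
      "apply_bcontfun (\<Delta> g) x = apply_bcontfun (T g) x"
      using ex[OF f g] by blast
    interpret function_isometry A B T by (rule T(1))
    have "D f - D g = u * apply_bcontfun (T (f - g)) x"
      using f g T by (simp add: D_def T_diff algebra_simps)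
    then have eq: "cmod (D f - D g) = cmod (apply_bcontfun (T (f - g)) x)"
      using u by (simp add: norm_mult)
    show "cmod (D f - D g) \<le> norm (f - g)"
      unfolding eq using norm_bounded[of "T (f - g)" x] norm_T[of "f - g"] f g by simp
    show "1 \<le> cmod (D f - D g) * norm h" if "h \<in> A" "(f - g) * h = 1"
      unfolding eq using f g that by (intro T_unit_lower_bound) auto
  qed
  have D_const: "D (const_bcontfun s) = s" for s
  proof -
    obtain T where T: "function_isometry A B T" "apply_bcontfun (\<Delta> 1) x = apply_bcontfun (T 1) x"
      "apply_bcontfun (\<Delta> (const_bcontfun s)) x = apply_bcontfun (T (const_bcontfun s)) x"
      using ex[OF A.one_mem A.const_mem] by blast
    interpret function_isometry A B T by (rule T(1))
    have "T (const_bcontfun s) = const_bcontfun s * T 1"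
      using T_const_mult[of 1 s] by simp
    then have "D (const_bcontfun s) = s * (apply_bcontfun (\<Delta> 1) x * cnj (apply_bcontfun (\<Delta> 1) x))"
      using T by (simp add: D_def u_def)
    then show ?thesis
      using u by (simp add: u_def complex_norm_square[symmetric])
  qed
  \<comment> \<open>The isometry chosen for \<open>f\<close> and \<open>f + s\<close> may have any
    unimodular value at \<open>1\<close>, so it determines only the modulus of the difference.
    Comparison with \<open>D_const\<close> shows that the resulting isometry of the plane stays near
    the identity.\<close>
  have D_add_const: "D (f + const_bcontfun s) = D f + s" if f: "f \<in> A" for f s
  proof -
    let ?\<phi> = "\<lambda>s. D (f + const_bcontfun s) - D f"
    have "?\<phi> s = s"
    proof (rule isometry_of_plane_near_identity)
      show "?\<phi> 0 = 0" by simp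
      show "cmod (?\<phi> s - s) \<le> 2 * norm f" for s
      proof -
        have "cmod (?\<phi> s - s) = cmod ((D (f + const_bcontfun s) - D (const_bcontfun s)) - (D f - D 0))"
          using D_const[of s] D_const[of 0] by (simp add: algebra_simps)
        also have "\<dots> \<le> cmod (D (f + const_bcontfun s) - D (const_bcontfun s)) + cmod (D f - D 0)"
          by (rule norm_triangle_ineq4)
        also have "\<dots> \<le> norm f + norm f"
          using pair(1)[of "f + const_bcontfun s" "const_bcontfun s"] pair(1)[of f 0] f by (intro add_mono) auto
        finally show ?thesis by simp
      qed
      show "cmod (?\<phi> s - ?\<phi> t) = cmod (s - t)" for s t
      proof (cases "s = t")
        case False
        let ?a = "f + const_bcontfun s" and ?b = "f + const_bcontfun t"
        let ?h = "const_bcontfun (1 / (s - t)) :: 'k \<Rightarrow>\<^sub>C complex"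
        have ab: "?a - ?b = const_bcontfun (s - t)" by (simp add: const_bcontfun_diff)
        have "(?a - ?b) * ?h = 1"
          unfolding ab using False by (simp add: const_bcontfun_mult[symmetric] const_bcontfun_1)
        then have "1 \<le> cmod (D ?a - D ?b) * norm ?h"
          using f by (intro pair(2)) auto
        then have "cmod (s - t) \<le> cmod (D ?a - D ?b)"
          using False by (simp add: norm_divide field_simps)
        moreover have "cmod (D ?a - D ?b) \<le> cmod (s - t)"
          using pair(1)[of ?a ?b] f unfolding ab by simp
        ultimately show ?thesis by simp
      qed simp
    qed
    then show ?thesis by (simp add: algebra_simps)
  qed
  have "D \<in> A.admissible"
    unfolding A.admissible_def
  proof (intro CollectI conjI ballI allI impI)
    fix f g y :: "'k \<Rightarrow>\<^sub>C complex" and s c :: complex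
    show "f \<notin> A \<Longrightarrow> D f = 0" by (simp add: D_def)
    show "D 0 = 0" using D_const[of 0] by simp
    assume f: "f \<in> A"
    show "cmod (D f - D g) \<le> norm (f - g)" if "g \<in> A" using pair(1) f that by blast
    show "D (f + const_bcontfun s) = D f + s" by (rule D_add_const[OF f])
    show "cmod c \<le> cmod (D (f + const_bcontfun c * exp y) - D f) * norm (exp (- y))" if y: "y \<in> A"
    proof (cases "c = 0")
      case False
      let ?h = "const_bcontfun (1 / c) * exp (- y)"
      have "1 \<le> cmod (D (f + const_bcontfun c * exp y) - D f) * norm ?h"
        using f y A.exp_units[OF y False] by (intro pair(2)) auto
      moreover have "norm ?h = norm (exp (- y)) / cmod c" by (simp add: norm_divide)
      ultimately have "1 \<le> cmod (D (f + const_bcontfun c * exp y) - D f) * (norm (exp (- y)) / cmod c)"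
        by (simp only:)
      then show ?thesis using False by (simp add: field_simps)
    qed simp
  qed
  then show "\<exists>u D. u \<noteq> 0 \<and> D \<in> A.admissible \<and> (\<forall>f\<in>A. D f = u * apply_bcontfun (\<Delta> f) x)"
    using u by (intro exI[of _ u] exI[of _ D]) (auto simp: D_def)
qed

end

theorem theorem3p9:
  fixes A :: "('k::t2_space \<Rightarrow>\<^sub>C complex) set"
    and B :: "('q::t2_space \<Rightarrow>\<^sub>C complex) set"
  assumes "uniform_algebra A"
    and "compact (UNIV :: 'q set)"
    and "closed B"
    and "subalgebra B"
    and "\<And>c. const_bcontfun c \<in> B"
  shows "(\<forall>\<Delta>. weak_2_local_isometry A B \<Delta> \<longrightarrow> clinear_on A scaleC_bcontfun \<Delta>) \<and>
         (\<forall>\<Delta>. weak_2_local_isomorphism A B \<Delta> \<longrightarrow> clinear_on A scaleC_bcontfun \<Delta>)"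
proof -
  interpret function_algebra_pair A B
    using assms by unfold_locales (auto simp: uniform_algebra_def)
  show ?thesis
    using weak_2_local_isometry_clinear weak_2_local_isomorphism_clinear by blast
qed

end
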